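(* Let $\Delta$ be a locally finite semiregular right-angled building over a finite index set $I$ with a fixed legal coloring $\lambda$, and let $\mathbf F=(F_i)_{i\in I}$, $\acute{\mathbf F}=(\acute F_i)_{i\in I}$ be local data with $F_i\leq\acute F_i\leq\widehat F_i\leq\operatorname{Sym}(\Omega_i)$ for every $i\in I$, such that $F_i=\acute F_i$ for every $i\in I$ that is the type of a rung in $\Delta$. Then the closure of $\mathcal G(\mathbf F,\acute{\mathbf F})$ in $\operatorname{Aut}(\Delta)$ (with the permutation topology) is $\mathcal U(\acute{\mathbf F})$.
   Context: Let $I$ be a finite set and $M=(m_{ij})_{i,j\in I}$ a right-angled Coxeter matrix: $m_{ii}=1$ and $m_{ij}\in\{2,\infty\}$ for $i\neq j$. $\Delta$ is a semiregular right-angled building of type $M$ with parameters $(q_i)_{i\in I}$ (each $i$-panel, i.e. residue of type $\{i\}$, has exactly $q_i$ chambers); it is identified with its set of chambers. Locally finite: all $q_i$ are finite. $\operatorname{Aut}(\Delta)$ is the group of type-preserving automorphisms. The permutation topology on $\operatorname{Aut}(\Delta)$ has as identity neighborhood basis the pointwise stabilizers of finite sets of chambers. Legal coloring: for each $i$ let $\Omega_i$ be a set of cardinality $q_i$; a legal coloring is a map $\lambda=(\lambda_i)_{i\in I}\colon\Delta\to\prod_{i\in I}\Omega_i$ such that for each $i$-panel $\mathcal P$ the restriction $\lambda_i|_{\mathcal P}\colon \mathcal P\to\Omega_i$ is a bijection and $\lambda_j|_{\mathcal P}$ is constant for every $j\neq i$. The local action of $g\in\operatorname{Aut}(\Delta)$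 at an $i$-panel $\mathcal P$ is $\sigma_\lambda(g,\mathcal P)=\lambda_i|_{g\mathcal P}\circ g|_{\mathcal P}\circ(\lambda_i|_{\mathcal P})^{-1}\in\operatorname{Sym}(\Omega_i)$. Local data $\mathbf F$: a family of permutation groups $F_i\leq\operatorname{Sym}(\Omega_i)$, $i\in I$. $\widehat F_i$ is the Young overgroup of $F_i$: the group of all permutations of $\Omega_i$ stabilizing each $F_i$-orbit. $\mathcal U(\acute{\mathbf F})$ is the group of $g\in\operatorname{Aut}(\Delta)$ with $\sigma_\lambda(g,\mathcal P)\in\acute F_i$ for all $i$ and all $i$-panels $\mathcal P$. $\mathcal G(\mathbf F)$ is the group of $g\in\operatorname{Aut}(\Delta)$ such that for every $i\in I$, $\sigma_\lambda(g,\mathcal P)\in F_i$ for all but finitely many $i$-panels $\mathcal P$. $\mathcal G(\mathbf F,\acute{\mathbf F})=\mathcal G(\mathbf F)\cap\mathcal U(\acute{\mathbf F})$. An index $i\in I$ is the type of a rung if there exist $j,k\in I$ with $m_{ij}=m_{ik}=2$ and $m_{jk}=\infty$. *)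

theory Defs
  imports "HOL-Analysis.Analysis" "HOL-Algebra.Algebra" "HOL-Library.Extended_Nat"
begin

section \<open>Coxeter groups\<close>

definition coxeter_matrix :: "'i set \<Rightarrow> ('i \<Rightarrow> 'i \<Rightarrow> enat) \<Rightarrow> bool" where
  "coxeter_matrix I M \<longleftrightarrow>
     (\<forall>i\<in>I. M i i = 1) \<and>
     (\<forall>i\<in>I. \<forall>j\<in>I. M i j = M j i) \<and>
     (\<forall>i\<in>I. \<forall>j\<in>I. i \<noteq> j \<longrightarrow> 2 \<le> M i j)"

definition right_angled :: "'i set \<Rightarrow> ('i \<Rightarrow> 'i \<Rightarrow> enat) \<Rightarrow> bool" where
  "right_angled I M \<longleftrightarrow> (\<forall>i\<in>I. \<forall>j\<in>I. i \<noteq> j \<longrightarrow> M i j \<in> {2, \<infinity>})"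

text \<open>
  The Coxeter group \<open>W = \<langle>I | (i j)^{m_ij} = 1 whenever m_ij < \<infinity>\<rangle>\<close> is presented as a quotient of the
  free monoid of words over \<open>I\<close>. Formal inverses of the generators are not needed, since the
  relations for \<open>i = j\<close> (where \<open>m_ii = 1\<close>) say that every generator is its own inverse.
\<close>

inductive cox_eq :: "'i set \<Rightarrow> ('i \<Rightarrow> 'i \<Rightarrow> enat) \<Rightarrow> 'i list \<Rightarrow> 'i list \<Rightarrow> bool"
  for I :: "'i set" and M :: "'i \<Rightarrow> 'i \<Rightarrow> enat" where
  refl: "w \<in> lists I \<Longrightarrow> cox_eq I M w w"
| sym: "cox_eq I M v w \<Longrightarrow> cox_eq I M w v"
| trans: "cox_eq I M u v \<Longrightarrow> cox_eq I M v w \<Longrightarrow> cox_eq I M u w"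
| rel: "u \<in> lists I \<Longrightarrow> v \<in> lists I \<Longrightarrow> i \<in> I \<Longrightarrow> j \<in> I \<Longrightarrow> M i j = enat m
        \<Longrightarrow> cox_eq I M (u @ concat (replicate m [i, j]) @ v) (u @ v)"

definition cox_rel :: "'i set \<Rightarrow> ('i \<Rightarrow> 'i \<Rightarrow> enat) \<Rightarrow> ('i list \<times> 'i list) set" where
  "cox_rel I M = {(v, w). cox_eq I M v w}"

text \<open>The underlying set of \<open>W\<close>, and the element of \<open>W\<close> represented by a word.\<close>

definition coxeter_group :: "'i set \<Rightarrow> ('i \<Rightarrow> 'i \<Rightarrow> enat) \<Rightarrow> 'i list set set" where
  "coxeter_group I M = lists I // cox_rel I M"

definition cox_elt :: "'i set \<Rightarrow> ('i \<Rightarrow> 'i \<Rightarrow> enat) \<Rightarrow> 'i list \<Rightarrow> 'i list set" where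
  "cox_elt I M w = cox_rel I M `` {w}"

definition reduced_word :: "'i set \<Rightarrow> ('i \<Rightarrow> 'i \<Rightarrow> enat) \<Rightarrow> 'i list \<Rightarrow> bool" where
  "reduced_word I M w \<longleftrightarrow> w \<in> lists I \<and> (\<forall>v. cox_eq I M w v \<longrightarrow> length w \<le> length v)"

section \<open>Buildings as chamber systems\<close>

record ('i, 'a) chamber_system =
  types :: "'i set"
  chambers :: "'a set"
  adj :: "'i \<Rightarrow> ('a \<times> 'a) set"

definition is_chamber_system :: "('i, 'a) chamber_system \<Rightarrow> bool" where
  "is_chamber_system \<Delta> \<longleftrightarrow> (\<forall>i\<in>types \<Delta>. equiv (chambers \<Delta>) (adj \<Delta> i))"

definition panels :: "('i, 'a) chamber_system \<Rightarrow> 'i \<Rightarrow> 'a set set" where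
  "panels \<Delta> i = chambers \<Delta> // adj \<Delta> i"

fun gallery :: "('i, 'a) chamber_system \<Rightarrow> 'i list \<Rightarrow> 'a \<Rightarrow> 'a \<Rightarrow> bool" where
  "gallery \<Delta> [] x y \<longleftrightarrow> x = y"
| "gallery \<Delta> (i # w) x y \<longleftrightarrow> (\<exists>z. (x, z) \<in> adj \<Delta> i \<and> x \<noteq> z \<and> gallery \<Delta> w z y)"

text \<open>
  A building of type \<open>M\<close>: a chamber system, all of whose panels have at least two chambers,
  that admits a Weyl distance \<open>\<delta>\<close> with values in the Coxeter group of \<open>M\<close>.
  As every element of \<open>W\<close> is represented by a reduced word, \<open>\<delta>\<close> is determined by the chamber
  system and need not be part of the data.
\<close>

definition weyl_distance ::
  "('i \<Rightarrow> 'i \<Rightarrow> enat) \<Rightarrow> ('i, 'a) chamber_system \<Rightarrow> ('a \<Rightarrow> 'a \<Rightarrow> 'i list set) \<Rightarrow> bool" where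
  "weyl_distance M \<Delta> \<delta> \<longleftrightarrow>
     (\<forall>x\<in>chambers \<Delta>. \<forall>y\<in>chambers \<Delta>.
        \<delta> x y \<in> coxeter_group (types \<Delta>) M \<and>
        (\<forall>w. reduced_word (types \<Delta>) M w \<longrightarrow>
           (\<delta> x y = cox_elt (types \<Delta>) M w \<longleftrightarrow> gallery \<Delta> w x y)))"

definition building :: "('i \<Rightarrow> 'i \<Rightarrow> enat) \<Rightarrow> ('i, 'a) chamber_system \<Rightarrow> bool" where
  "building M \<Delta> \<longleftrightarrow>
     coxeter_matrix (types \<Delta>) M \<and>
     is_chamber_system \<Delta> \<and>
     chambers \<Delta> \<noteq> {} \<and>
     (\<forall>i\<in>types \<Delta>. \<forall>P\<in>panels \<Delta> i. \<exists>x\<in>P. \<exists>y\<in>P. x \<noteq> y) \<and>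
     (\<exists>\<delta>. weyl_distance M \<Delta> \<delta>)"

definition right_angled_building :: "('i \<Rightarrow> 'i \<Rightarrow> enat) \<Rightarrow> ('i, 'a) chamber_system \<Rightarrow> bool" where
  "right_angled_building M \<Delta> \<longleftrightarrow> building M \<Delta> \<and> right_angled (types \<Delta>) M"

text \<open>Semiregular with parameters \<open>(q_i)\<close>, all of them finite.\<close>

definition locally_finite_semiregular :: "('i, 'a) chamber_system \<Rightarrow> ('i \<Rightarrow> nat) \<Rightarrow> bool" where
  "locally_finite_semiregular \<Delta> q \<longleftrightarrow>
     (\<forall>i\<in>types \<Delta>. \<forall>P\<in>panels \<Delta> i. finite P \<and> card P = q i)"

definition rung_type :: "'i set \<Rightarrow> ('i \<Rightarrow> 'i \<Rightarrow> enat) \<Rightarrow> 'i \<Rightarrow> bool" where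
  "rung_type I M i \<longleftrightarrow> i \<in> I \<and> (\<exists>j\<in>I. \<exists>k\<in>I. M i j = 2 \<and> M i k = 2 \<and> M j k = \<infinity>)"

section \<open>Automorphisms and the permutation topology\<close>

text \<open>As in \<^const>\<open>Bij\<close>, permutations of a set are functions that are \<open>undefined\<close> outside of it.\<close>

definition Aut :: "('i, 'a) chamber_system \<Rightarrow> ('a \<Rightarrow> 'a) set" where
  "Aut \<Delta> = {g \<in> Bij (chambers \<Delta>).
      \<forall>i\<in>types \<Delta>. \<forall>x\<in>chambers \<Delta>. \<forall>y\<in>chambers \<Delta>. (x, y) \<in> adj \<Delta> i \<longleftrightarrow> (g x, g y) \<in> adj \<Delta> i}"

definition Aut_group :: "('i, 'a) chamber_system \<Rightarrow> ('a \<Rightarrow> 'a) monoid" where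
  "Aut_group \<Delta> = (BijGroup (chambers \<Delta>))\<lparr>carrier := Aut \<Delta>\<rparr>"

definition pointwise_stabilizer :: "('i, 'a) chamber_system \<Rightarrow> 'a set \<Rightarrow> ('a \<Rightarrow> 'a) set" where
  "pointwise_stabilizer \<Delta> S = {g \<in> Aut \<Delta>. \<forall>c\<in>S. g c = c}"

text \<open>
  The group topology for which the pointwise stabilizers of finite sets of chambers form a
  neighborhood basis of the identity; their left translates by \<open>g\<close> then form one of \<open>g\<close>.
\<close>

definition perm_open :: "('i, 'a) chamber_system \<Rightarrow> ('a \<Rightarrow> 'a) set \<Rightarrow> bool" where
  "perm_open \<Delta> U \<longleftrightarrow> U \<subseteq> Aut \<Delta> \<and>
     (\<forall>g\<in>U. \<exists>S. finite S \<and> S \<subseteq> chambers \<Delta> \<and>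
        g <#\<^bsub>Aut_group \<Delta>\<^esub> pointwise_stabilizer \<Delta> S \<subseteq> U)"

definition permutation_topology :: "('i, 'a) chamber_system \<Rightarrow> ('a \<Rightarrow> 'a) topology" where
  "permutation_topology \<Delta> = topology (perm_open \<Delta>)"

lemma istopology_perm_open: "istopology (perm_open \<Delta>)"
  unfolding istopology_def
proof (intro conjI allI impI)
  fix U V assume U: "perm_open \<Delta> U" and V: "perm_open \<Delta> V"
  show "perm_open \<Delta> (U \<inter> V)"
    unfolding perm_open_def
  proof (intro conjI ballI)
    show "U \<inter> V \<subseteq> Aut \<Delta>" using U by (auto simp: perm_open_def)
    fix g assume g: "g \<in> U \<inter> V"
    obtain S where S: "finite S" "S \<subseteq> chambers \<Delta>"
      "g <#\<^bsub>Aut_group \<Delta>\<^esub> pointwise_stabilizer \<Delta> S \<subseteq> U"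
      using U g unfolding perm_open_def by blast
    obtain T where T: "finite T" "T \<subseteq> chambers \<Delta>"
      "g <#\<^bsub>Aut_group \<Delta>\<^esub> pointwise_stabilizer \<Delta> T \<subseteq> V"
      using V g unfolding perm_open_def by blast
    have "g <#\<^bsub>Aut_group \<Delta>\<^esub> pointwise_stabilizer \<Delta> (S \<union> T) \<subseteq> U \<inter> V"
      using S(3) T(3) by (fastforce simp: l_coset_def pointwise_stabilizer_def)
    then show "\<exists>S. finite S \<and> S \<subseteq> chambers \<Delta> \<and>
        g <#\<^bsub>Aut_group \<Delta>\<^esub> pointwise_stabilizer \<Delta> S \<subseteq> U \<inter> V"
      using S T by (intro exI[of _ "S \<union> T"]) auto
  qed
next
  fix K assume "\<forall>U\<in>K. perm_open \<Delta> U"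
  then show "perm_open \<Delta> (\<Union>K)"
    unfolding perm_open_def by (meson Sup_least Union_iff Union_upper order_trans)
qed

lemma openin_permutation_topology: "openin (permutation_topology \<Delta>) U \<longleftrightarrow> perm_open \<Delta> U"
  by (simp add: permutation_topology_def istopology_perm_open)

lemma Aut_compose:
  assumes "g \<in> Aut \<Delta>" "h \<in> Aut \<Delta>"
  shows "g \<otimes>\<^bsub>Aut_group \<Delta>\<^esub> h \<in> Aut \<Delta>"
proof -
  have "h x \<in> chambers \<Delta>" if "x \<in> chambers \<Delta>" for x
    using assms(2) that Bij_imp_funcset by (fastforce simp: Aut_def)
  with assms show ?thesis
    by (auto simp: Aut_group_def BijGroup_def Aut_def compose_Bij compose_eq)
qed

lemma topspace_permutation_topology: "topspace (permutation_topology \<Delta>) = Aut \<Delta>"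
proof -
  have "perm_open \<Delta> (Aut \<Delta>)"
    unfolding perm_open_def
    by (auto simp: l_coset_def pointwise_stabilizer_def intro!: exI[of _ "{}"] Aut_compose)
  then show ?thesis
    using openin_permutation_topology by (metis openin_subset openin_topspace perm_open_def subset_antisym)
qed

section \<open>Legal colorings and local actions\<close>

text \<open>The coloring is given by its components \<open>lam i\<close>, which take values in \<open>\<Omega> i\<close>.\<close>

definition legal_coloring ::
  "('i, 'a) chamber_system \<Rightarrow> ('i \<Rightarrow> 'c set) \<Rightarrow> ('i \<Rightarrow> 'a \<Rightarrow> 'c) \<Rightarrow> bool" where
  "legal_coloring \<Delta> \<Omega> lam \<longleftrightarrow>
     (\<forall>i\<in>types \<Delta>. lam i \<in> chambers \<Delta> \<rightarrow> \<Omega> i) \<and>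
     (\<forall>i\<in>types \<Delta>. \<forall>P\<in>panels \<Delta> i.
        bij_betw (lam i) P (\<Omega> i) \<and>
        (\<forall>j\<in>types \<Delta>. j \<noteq> i \<longrightarrow> lam j constant_on P))"

definition local_action ::
  "('i \<Rightarrow> 'c set) \<Rightarrow> ('i \<Rightarrow> 'a \<Rightarrow> 'c) \<Rightarrow> ('a \<Rightarrow> 'a) \<Rightarrow> 'i \<Rightarrow> 'a set \<Rightarrow> 'c \<Rightarrow> 'c" where
  "local_action \<Omega> lam g i P = (\<lambda>\<omega>\<in>\<Omega> i. lam i (g (inv_into P (lam i) \<omega>)))"

section \<open>Universal groups\<close>

definition local_data :: "'i set \<Rightarrow> ('i \<Rightarrow> 'c set) \<Rightarrow> ('i \<Rightarrow> ('c \<Rightarrow> 'c) set) \<Rightarrow> bool" where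
  "local_data I \<Omega> F \<longleftrightarrow> (\<forall>i\<in>I. subgroup (F i) (BijGroup (\<Omega> i)))"

definition young_overgroup :: "'c set \<Rightarrow> ('c \<Rightarrow> 'c) set \<Rightarrow> ('c \<Rightarrow> 'c) set" where
  "young_overgroup A F =
     {\<pi> \<in> Bij A. \<forall>Y \<in> orbits ((BijGroup A)\<lparr>carrier := F\<rparr>) A id. \<pi> ` Y = Y}"

definition universal_group ::
  "('i, 'a) chamber_system \<Rightarrow> ('i \<Rightarrow> 'c set) \<Rightarrow> ('i \<Rightarrow> 'a \<Rightarrow> 'c) \<Rightarrow> ('i \<Rightarrow> ('c \<Rightarrow> 'c) set)
     \<Rightarrow> ('a \<Rightarrow> 'a) set" where
  "universal_group \<Delta> \<Omega> lam F =
     {g \<in> Aut \<Delta>. \<forall>i\<in>types \<Delta>. \<forall>P\<in>panels \<Delta> i. local_action \<Omega> lam g i P \<in> F i}"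

definition G_group ::
  "('i, 'a) chamber_system \<Rightarrow> ('i \<Rightarrow> 'c set) \<Rightarrow> ('i \<Rightarrow> 'a \<Rightarrow> 'c) \<Rightarrow> ('i \<Rightarrow> ('c \<Rightarrow> 'c) set)
     \<Rightarrow> ('a \<Rightarrow> 'a) set" where
  "G_group \<Delta> \<Omega> lam F =
     {g \<in> Aut \<Delta>. \<forall>i\<in>types \<Delta>. finite {P \<in> panels \<Delta> i. local_action \<Omega> lam g i P \<notin> F i}}"

definition restricted_universal_group ::
  "('i, 'a) chamber_system \<Rightarrow> ('i \<Rightarrow> 'c set) \<Rightarrow> ('i \<Rightarrow> 'a \<Rightarrow> 'c) \<Rightarrow> ('i \<Rightarrow> ('c \<Rightarrow> 'c) set)
     \<Rightarrow> ('i \<Rightarrow> ('c \<Rightarrow> 'c) set) \<Rightarrow> ('a \<Rightarrow> 'a) set" where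
  "restricted_universal_group \<Delta> \<Omega> lam F F' = G_group \<Delta> \<Omega> lam F \<inter> universal_group \<Delta> \<Omega> lam F'"

end

theory Submission
  imports Defs
begin

text \<open>
  Given \<open>g \<in> \<U>(F')\<close> and a ball around a chamber \<open>c\<close>, we look for \<open>h \<in> \<G>(F, F')\<close> that agrees with \<open>g\<close> on
  the ball. An automorphism \<open>h\<close> is determined by \<open>h c\<close> and the legal coloring \<open>\<lambda> \<circ> h\<close>, and every legal
  coloring with the right colors at \<open>c\<close> arises in this way. As the components of a legal coloring can
  be prescribed independently of each other, it is enough to modify each \<open>\<mu> = \<lambda>\<^sub>i \<circ> g\<close> outside the ball.
  If \<open>i\<close> is the type of a rung, \<open>\<mu>\<close> is kept. Otherwise the residues of type \<open>{i} \<union> i\<^sup>\<bottom>\<close> are finite, so only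
  finitely many \<open>i\<close>-panels lie in such a residue that meets the ball; there \<open>\<mu>\<close> is kept too. On the other
  \<open>i\<close>-panels the coloring is extended outwards from the chamber closest to \<open>c\<close> by an element of \<open>F\<^sub>i\<close>, which
  exists because \<open>\<lambda>\<^sub>i\<close> and the new coloring always take values in the same \<open>F\<^sub>i\<close>-orbit.
\<close>

section \<open>Right-angled Coxeter groups\<close>

lemma cox_eq_lists:
  assumes "cox_eq I M u v"
  shows "u \<in> lists I" "v \<in> lists I"
  using assms
proof (induction)
  case (rel u v i j m)
  { case 1 show ?case using rel by (auto simp: in_lists_conv_set) }
  { case 2 show ?case using rel by auto }
qed auto

lemma cox_eq_context:
  assumes "cox_eq I M u v" "a \<in> lists I" "b \<in> lists I"
  shows "cox_eq I M (a @ u @ b) (a @ v @ b)"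
  using assms(1)
proof (induction)
  case (refl w)
  then show ?case using assms by (intro cox_eq.refl) auto
next
  case (sym v w)
  show ?case by (rule cox_eq.sym) (rule sym.IH)
next
  case (trans u v w)
  then show ?case by (blast intro: cox_eq.trans)
next
  case (rel u v i j m)
  then show ?case
    using cox_eq.rel[of "a @ u" I "v @ b" i j M m] assms by simp
qed

text \<open>All relators have even length, so the parity of the length is an invariant of the group
  element; this later excludes that appending a generator preserves the minimal length.\<close>

lemma cox_eq_parity: "cox_eq I M u v \<Longrightarrow> even (length u) \<longleftrightarrow> even (length v)"
proof (induction rule: cox_eq.induct)
  case (rel u v i j m)
  have "length (concat (replicate m [i, j])) = 2 * m" by (induction m) auto
  then show ?case by simp
qed auto

locale racg =
  fixes I :: "'i set" and M :: "'i \<Rightarrow> 'i \<Rightarrow> enat"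
  assumes coxeter: "coxeter_matrix I M" and right_angled: "right_angled I M"
begin

abbreviation cox (infix "\<equiv>\<^sub>W" 50) where "u \<equiv>\<^sub>W v \<equiv> cox_eq I M u v"

abbreviation reduced where "reduced \<equiv> reduced_word I M"

lemma M_sym: "i \<in> I \<Longrightarrow> j \<in> I \<Longrightarrow> M i j = M j i"
  using coxeter by (simp add: coxeter_matrix_def)

lemma M_diag: "i \<in> I \<Longrightarrow> M i i = 1"
  using coxeter by (simp add: coxeter_matrix_def)

lemma M_cases: "i \<in> I \<Longrightarrow> j \<in> I \<Longrightarrow> i \<noteq> j \<Longrightarrow> M i j = 2 \<or> M i j = \<infinity>"
  using right_angled by (auto simp: right_angled_def simp del: not_infinity_eq not_enat_eq)

text \<open>The diagonal is included: a letter does not move past another copy of itself, and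
  \<open>pr w i i\<close> then records how often \<open>i\<close> occurs in
  \<open>w\<close>.\<close>

definition nc :: "'i \<Rightarrow> 'i \<Rightarrow> bool" where
  "nc i k \<longleftrightarrow> i \<in> I \<and> k \<in> I \<and> (i = k \<or> M i k = \<infinity>)"

lemma nc_sym: "nc i k \<longleftrightarrow> nc k i"
  unfolding nc_def using M_sym by auto

lemma nc_refl: "i \<in> I \<Longrightarrow> nc i i"
  by (simp add: nc_def)

lemma not_nc: "i \<in> I \<Longrightarrow> j \<in> I \<Longrightarrow> \<not> nc i j \<longleftrightarrow> M i j = 2"
  using M_cases[of i j] M_diag[of i]
  by (cases "i = j") (auto simp: nc_def numeral_eq_enat one_enat_def)

lemma cox_cancel:
  assumes "u \<in> lists I" "v \<in> lists I" "i \<in> I"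
  shows "u @ [i, i] @ v \<equiv>\<^sub>W u @ v"
  using cox_eq.rel[of u I v i i M 1] assms M_diag by (simp add: one_enat_def)

lemma cox_swap:
  assumes "u \<in> lists I" "v \<in> lists I" "i \<in> I" "j \<in> I" "M i j = 2"
  shows "u @ [i, j] @ v \<equiv>\<^sub>W u @ [j, i] @ v"
proof -
  \<comment> \<open>Both sides are reached from one longer word: dropping the relator
    \<open>[i,j,i,j]\<close> leaves \<open>[j,i]\<close>, while cancelling \<open>[j,j]\<close> and
    then \<open>[i,i]\<close> leaves \<open>[i,j]\<close>.\<close>
  have "u @ [i,j,i,j] @ [j,i] @ v \<equiv>\<^sub>W u @ [j,i] @ v"
    using cox_eq.rel[of u I "[j,i] @ v" i j M 2] assms
    by (simp add: numeral_2_eq_2 numeral_eq_enat)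
  moreover have "u @ [i,j,i,j] @ [j,i] @ v \<equiv>\<^sub>W u @ [i,j,i,i] @ v"
    using cox_cancel[of "u @ [i,j,i]" "i # v" j] assms by simp
  moreover have "u @ [i,j,i,i] @ v \<equiv>\<^sub>W u @ [i,j] @ v"
    using cox_cancel[of "u @ [i,j]" v i] assms by simp
  ultimately show ?thesis by (meson cox_eq.sym cox_eq.trans)
qed

lemma cox_move:
  assumes "a \<in> lists I" "b \<in> lists I" "j \<in> I" "\<forall>x\<in>set b. \<not> nc j x"
  shows "a @ j # b \<equiv>\<^sub>W a @ b @ [j]"
  using assms
proof (induction b arbitrary: a)
  case Nil
  then show ?case by (simp add: cox_eq.refl)
next
  case (Cons x b)
  have "a @ [j, x] @ b \<equiv>\<^sub>W a @ [x, j] @ b"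
    using Cons.prems not_nc by (intro cox_swap) auto
  moreover have "(a @ [x]) @ j # b \<equiv>\<^sub>W (a @ [x]) @ b @ [j]"
    using Cons.prems by (intro Cons.IH) auto
  ultimately show ?case by (auto intro: cox_eq.trans)
qed

section \<open>The word problem in right-angled Coxeter groups\<close>

text \<open>
  A word is recorded, up to commutations, by its projections to the pairs of non-commuting letters.
  The generators act on such families by cancelling a final letter where possible.
\<close>

definition pr :: "'i list \<Rightarrow> 'i \<Rightarrow> 'i \<Rightarrow> 'i list" where
  "pr w i k = (if nc i k then filter (\<lambda>x. x = i \<or> x = k) w else [])"

text \<open>For \<open>S = pr w\<close> this encodes that some occurrence of \<open>j\<close> in
  \<open>w\<close> can be commuted to the end of the word; see \<open>pr_final_iff\<close>.\<close>

definition final :: "'i \<Rightarrow> ('i \<Rightarrow> 'i \<Rightarrow> 'i list) \<Rightarrow> bool" where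
  "final j S \<longleftrightarrow> (\<forall>k. nc j k \<longrightarrow> S j k \<noteq> [] \<and> last (S j k) = j)"

definition act :: "'i \<Rightarrow> ('i \<Rightarrow> 'i \<Rightarrow> 'i list) \<Rightarrow> 'i \<Rightarrow> 'i \<Rightarrow> 'i list" where
  "act j S = (\<lambda>i k. if nc i k \<and> (i = j \<or> k = j)
     then (if final j S then butlast (S i k) else S i k @ [j]) else S i k)"

lemma pr_snoc:
  "pr (w @ [j]) = (\<lambda>i k. if nc i k \<and> (i = j \<or> k = j) then pr w i k @ [j] else pr w i k)"
  by (intro ext) (auto simp: pr_def)

lemma pr_move:
  assumes "j \<in> I" "\<forall>x\<in>set b. \<not> nc j x"
  shows "pr (a @ j # b) = pr (a @ b @ [j])"
proof (intro ext)
  fix i k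
  show "pr (a @ j # b) i k = pr (a @ b @ [j]) i k"
  proof (cases "nc i k \<and> (i = j \<or> k = j)")
    case True
    then have "filter (\<lambda>x. x = i \<or> x = k) b = []"
      using assms nc_sym nc_refl by (auto simp: filter_empty_conv)
    with True show ?thesis by (simp add: pr_def)
  next
    case False
    then show ?thesis by (auto simp: pr_def)
  qed
qed

text \<open>Consider the last occurrence of \<open>j\<close>. If a later letter \<open>x\<close> had
  \<open>nc j x\<close>, the projection of the tail to \<open>j\<close> and \<open>x\<close> would
  be nonempty and free of \<open>j\<close>, so the whole projection would not end in
  \<open>j\<close>.\<close>

lemma pr_final_iff:
  assumes "w \<in> lists I" "j \<in> I"
  shows "final j (pr w) \<longleftrightarrow> (\<exists>a b. w = a @ j # b \<and> (\<forall>x\<in>set b. \<not> nc j x))"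
proof
  assume f: "final j (pr w)"
  then have "pr w j j \<noteq> []" using nc_refl assms by (auto simp: final_def)
  then have "j \<in> set w" using nc_refl assms by (auto simp: pr_def filter_empty_conv)
  then obtain a b where w: "w = a @ j # b" "j \<notin> set b" by (meson split_list_last)
  have "\<not> nc j x" if x: "x \<in> set b" for x
  proof
    assume "nc j x"
    let ?f = "filter (\<lambda>y. y = j \<or> y = x)"
    have "?f b \<noteq> []" using x by (auto simp: filter_empty_conv)
    moreover have "last (pr w j x) = j" using f \<open>nc j x\<close> by (auto simp: final_def)
    ultimately have "last (?f b) = j" using \<open>nc j x\<close> by (simp add: pr_def w)
    then have "j \<in> set (?f b)" using \<open>?f b \<noteq> []\<close> last_in_set by metis
    then show False using w by simp
  qed
  then show "\<exists>a b. w = a @ j # b \<and> (\<forall>x\<in>set b. \<not> nc j x)" using w by blast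
next
  assume "\<exists>a b. w = a @ j # b \<and> (\<forall>x\<in>set b. \<not> nc j x)"
  then obtain a b where w: "w = a @ j # b" "\<forall>x\<in>set b. \<not> nc j x" by blast
  have "pr w = pr ((a @ b) @ [j])" using pr_move[OF assms(2) w(2)] w(1) by simp
  then show "final j (pr w)" by (simp add: final_def pr_snoc del: append_assoc)
qed

lemma act_pr_final:
  assumes "j \<in> I" "\<forall>x\<in>set b. \<not> nc j x"
  shows "act j (pr (a @ j # b)) = pr (a @ b)"
proof -
  have *: "pr (a @ j # b) = pr ((a @ b) @ [j])" using pr_move[OF assms] by simp
  have "final j (pr ((a @ b) @ [j]))" by (simp add: final_def pr_snoc del: append_assoc)
  then show ?thesis unfolding * act_def by (intro ext) (simp add: pr_snoc del: append_assoc)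
qed

lemma act_pr_not_final: "\<not> final j (pr w) \<Longrightarrow> act j (pr w) = pr (w @ [j])"
  unfolding act_def by (intro ext) (simp add: pr_snoc)

text \<open>While such a word is read from left to right, \<open>act\<close> never cancels, so
  \<open>pr w\<close> arises from \<open>pr []\<close> by appending only.\<close>

definition irr :: "'i list \<Rightarrow> bool" where
  "irr w \<longleftrightarrow> (\<forall>u j v. w = u @ j # v \<longrightarrow> \<not> final j (pr u))"

lemma irr_Nil: "irr []"
  by (simp add: irr_def)

lemma irr_snoc: "irr (w @ [j]) \<longleftrightarrow> irr w \<and> \<not> final j (pr w)"
proof
  assume r: "irr (w @ [j])"
  have "\<not> final k (pr u)" if "w = u @ k # v" for u k v
  proof -
    have "w @ [j] = u @ k # (v @ [j])" using that by simp
    then show ?thesis using r unfolding irr_def by blast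
  qed
  then show "irr w \<and> \<not> final j (pr w)" using r unfolding irr_def by blast
next
  assume r: "irr w \<and> \<not> final j (pr w)"
  show "irr (w @ [j])" unfolding irr_def
  proof (intro allI impI)
    fix u k v assume e: "w @ [j] = u @ k # v"
    show "\<not> final k (pr u)"
    proof (cases v rule: rev_cases)
      case Nil
      then show ?thesis using e r by simp
    next
      case (snoc v' y)
      then have "w = u @ k # v'" using e by simp
      then show ?thesis using r unfolding irr_def by blast
    qed
  qed
qed

text \<open>Every letter \<open>k\<close> of \<open>b\<close> commutes with \<open>j\<close>, so the
  projections that decide whether \<open>k\<close> is final contain no \<open>j\<close> and are not
  affected by the deletion.\<close>

lemma irr_delete:
  assumes "irr (a @ j # b)" "\<forall>x\<in>set b. \<not> nc j x" "j \<in> I"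
  shows "irr (a @ b)"
  using assms(1,2)
proof (induction b rule: rev_induct)
  case Nil
  then show ?case using irr_snoc by simp
next
  case (snoc k b)
  have "irr ((a @ j # b) @ [k])" using snoc.prems by simp
  then have 1: "irr (a @ j # b)" "\<not> final k (pr (a @ j # b))" using irr_snoc by blast+
  have "pr (a @ j # b) = pr ((a @ b) @ [j])"
    using pr_move[OF assms(3), of b a] snoc.prems by simp
  moreover have "\<not> nc j k" using snoc.prems by simp
  moreover have "\<not> nc k j" "j \<noteq> k"
    using \<open>\<not> nc j k\<close> nc_sym nc_refl[OF assms(3)] by auto
  ultimately have "final k (pr (a @ j # b)) = final k (pr (a @ b))"
    by (auto simp: final_def pr_snoc simp del: append_assoc)
  moreover have "irr (a @ b)" using 1 snoc by simp
  ultimately have "irr ((a @ b) @ [k])" using 1 irr_snoc by blast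
  then show ?case by simp
qed

text \<open>Irreducibility is what makes each generator act as an involution: from
  \<open>pr [j, j]\<close>, two applications of \<open>act j\<close> would cancel twice.\<close>

definition states :: "('i \<Rightarrow> 'i \<Rightarrow> 'i list) set" where
  "states = pr ` {w \<in> lists I. irr w}"

lemma act_states:
  assumes "S \<in> states" "j \<in> I"
  shows "act j S \<in> states"
proof -
  obtain w where w: "w \<in> lists I" "irr w" "S = pr w" using assms by (auto simp: states_def)
  show ?thesis
  proof (cases "final j S")
    case True
    then obtain a b where ab: "w = a @ j # b" "\<forall>x\<in>set b. \<not> nc j x"
      using pr_final_iff[of w j] w assms by auto
    then have "act j S = pr (a @ b)" "irr (a @ b)" "a @ b \<in> lists I"
      using w act_pr_final assms irr_delete by auto
    then show ?thesis by (auto simp: states_def)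
  next
    case False
    then have "act j S = pr (w @ [j])" "irr (w @ [j])" "w @ [j] \<in> lists I"
      using w act_pr_not_final assms irr_snoc by auto
    then show ?thesis unfolding states_def by blast
  qed
qed

lemma act_act:
  assumes "S \<in> states" "j \<in> I"
  shows "act j (act j S) = S"
proof -
  obtain w where w: "w \<in> lists I" "irr w" "S = pr w" using assms by (auto simp: states_def)
  show ?thesis
  proof (cases "final j S")
    case True
    then obtain a b where ab: "w = a @ j # b" "\<forall>x\<in>set b. \<not> nc j x"
      using pr_final_iff[of w j] w assms by auto
    have 1: "act j S = pr (a @ b)" using ab w act_pr_final assms by auto
    \<comment> \<open>Since \<open>w\<close> is irreducible, cancelling this \<open>j\<close> does
      not make an earlier one final, so the second application appends \<open>j\<close>
      again.\<close>
    have "\<not> final j (pr a)" using w(2) ab(1) unfolding irr_def by blast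
    moreover have "pr (a @ b) j k = pr a j k" if "nc j k" for k
    proof -
      have "filter (\<lambda>x. x = j \<or> x = k) b = []"
        using ab(2) that assms nc_refl by (auto simp: filter_empty_conv)
      then show ?thesis by (simp add: pr_def)
    qed
    ultimately have "\<not> final j (pr (a @ b))" by (auto simp: final_def)
    then have "act j (act j S) = pr (a @ b @ [j])" using 1 act_pr_not_final by simp
    also have "\<dots> = S" using pr_move[OF assms(2) ab(2)] w(3) ab(1) by simp
    finally show ?thesis .
  next
    case False
    then have "act j S = pr (w @ [j])" using w act_pr_not_final assms by auto
    then show ?thesis using act_pr_final[of j "[]" w] assms w by simp
  qed
qed

text \<open>The two generators edit disjoint sets of projections, and neither edit touches the
  projections tested for the other's finality.\<close>

lemma act_commute:
  assumes "j \<in> I" "\<not> nc j k"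
  shows "act k (act j S) = act j (act k S)"
proof -
  have jk: "\<not> nc k j" "j \<noteq> k" using assms nc_sym nc_refl by auto
  have 1: "final k (act j S) = final k S"
    using assms jk by (auto simp: final_def act_def)
  have 2: "final j (act k S) = final j S"
    using assms jk by (auto simp: final_def act_def)
  have "act k (act j S) a b = act j (act k S) a b" for a b
    unfolding act_def[of k "act j S"] act_def[of j "act k S"] 1 2
    using assms jk by (auto simp: act_def)
  then show ?thesis by blast
qed

lemma fold_act_states: "w \<in> lists I \<Longrightarrow> S \<in> states \<Longrightarrow> fold act w S \<in> states"
  by (induction w arbitrary: S) (auto simp: act_states)

text \<open>In the right-angled case the relators only say that generators are involutions and that
  certain pairs commute, so \<open>act_act\<close> and \<open>act_commute\<close> yield an action of
  the Coxeter group on \<open>states\<close>.\<close>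

lemma fold_act_cox:
  assumes "u \<equiv>\<^sub>W v" "S \<in> states"
  shows "fold act u S = fold act v S"
  using assms
proof (induction arbitrary: S)
  case (rel u v i j m)
  let ?T = "fold act u S"
  have T: "?T \<in> states" using rel fold_act_states by blast
  have "fold act (concat (replicate m [i, j])) ?T = ?T"
  proof (cases "i = j")
    case True
    then have "m = 1" using M_diag[of i] rel by (simp add: one_enat_def)
    then show ?thesis using True T act_act rel by simp
  next
    case False
    then have "M i j = 2" using M_cases[of i j] rel by auto
    then have "m = 2" "\<not> nc i j" using rel not_nc by (auto simp: numeral_eq_enat)
    then show ?thesis
      using T act_act rel act_states by (simp add: numeral_2_eq_2 act_commute[of i j])
  qed
  then show ?case by simp
qed simp_all

text \<open>Greedy reduction: append the letters one by one and cancel whenever the new letter is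
  already final. Equal lengths mean that nothing was cancelled, which makes a reduced word its own
  normal form.\<close>

lemma normal_form:
  assumes "w \<in> lists I"
  shows "\<exists>v\<in>lists I. irr v \<and> pr v = fold act w (pr []) \<and> v \<equiv>\<^sub>W w \<and>
    length v \<le> length w \<and> (length v = length w \<longrightarrow> v = w)"
  using assms
proof (induction w rule: rev_induct)
  case Nil
  then show ?case by (auto simp: irr_Nil cox_eq.refl)
next
  case (snoc j w)
  then obtain v where v: "v \<in> lists I" "irr v" "pr v = fold act w (pr [])" "v \<equiv>\<^sub>W w"
    "length v \<le> length w" "length v = length w \<longrightarrow> v = w" by auto
  have j: "j \<in> I" using snoc by simp
  have vj: "v @ [j] \<equiv>\<^sub>W w @ [j]"
    using cox_eq_context[of I M v w "[]" "[j]"] v j by simp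
  show ?case
  proof (cases "final j (pr v)")
    case True
    then obtain a b where ab: "v = a @ j # b" "\<forall>x\<in>set b. \<not> nc j x"
      using pr_final_iff[of v j] v j by auto
    have l: "a \<in> lists I" "b \<in> lists I" using v ab by auto
    have "(a @ b) @ [j, j] @ [] \<equiv>\<^sub>W (a @ b) @ []"
      using l j by (intro cox_cancel) auto
    moreover have "v @ [j] \<equiv>\<^sub>W (a @ b @ [j]) @ [j]"
      using cox_eq_context[OF cox_move[OF l j ab(2)], of "[]" "[j]"] ab j by simp
    ultimately have "a @ b \<equiv>\<^sub>W w @ [j]" using vj
      by (simp, meson cox_eq.sym cox_eq.trans)
    moreover have "pr (a @ b) = fold act (w @ [j]) (pr [])"
      using v(3) act_pr_final[OF j ab(2), of a] ab(1) by simp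
    moreover have "irr (a @ b)" using irr_delete ab v j by blast
    ultimately show ?thesis
      using l v(5) ab by (intro bexI[of _ "a @ b"]) auto
  next
    case False
    have "irr (v @ [j])" using False v irr_snoc by simp
    moreover have "pr (v @ [j]) = fold act (w @ [j]) (pr [])"
      using v(3) act_pr_not_final[OF False] by simp
    ultimately show ?thesis
      using vj v j by (intro bexI[of _ "v @ [j]"]) auto
  qed
qed

text \<open>The diagonal projections \<open>pr w i i\<close> determine the multiplicity of each
  letter.\<close>

lemma pr_eq_length:
  assumes "pr u = pr v" "u \<in> lists I" "v \<in> lists I"
  shows "length u = length v"
proof -
  have "count (mset u) i = count (mset v) i" for i
  proof (cases "i \<in> I")
    case True
    have "filter (\<lambda>x. x = i) w = pr w i i" for w using True nc_refl by (simp add: pr_def)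
    then have "filter (\<lambda>x. x = i) u = filter (\<lambda>x. x = i) v" using assms by simp
    moreover have "count (mset w) i = length (filter (\<lambda>x. x = i) w)" for w
      by (induction w) auto
    ultimately show ?thesis by simp
  next
    case False
    then have "i \<notin> set u" "i \<notin> set v" using assms by auto
    then have "i \<notin># mset u" "i \<notin># mset v" by auto
    then show ?thesis unfolding not_in_iff by metis
  qed
  then have "mset u = mset v" by (rule multiset_eqI)
  then show ?thesis by (metis size_mset)
qed

section \<open>Right descents of reduced words\<close>

lemma reducedD:
  assumes "reduced w"
  shows "w \<in> lists I" "w \<equiv>\<^sub>W v \<Longrightarrow> length w \<le> length v"
  using assms by (auto simp: reduced_word_def)

text \<open>If \<open>j\<close> were not final in \<open>w\<close>, then \<open>w @ [j]\<close>
  would have the projections attached to its group element. The normal form of a shorter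
  representative has the same projections, hence the same length, which is absurd.\<close>

theorem reduced_snoc_fails:
  assumes w: "reduced w" and j: "j \<in> I" and "\<not> reduced (w @ [j])"
  obtains a b where "w = a @ j # b" "\<forall>x\<in>set b. \<not> nc j x"
proof -
  have wI: "w \<in> lists I" using w reducedD by blast
  obtain v where v: "v \<in> lists I" "irr v" "pr v = fold act w (pr [])" "v \<equiv>\<^sub>W w"
    "length v \<le> length w" "length v = length w \<longrightarrow> v = w"
    using normal_form[OF wI] by blast
  \<comment> \<open>The normal form of \<open>w\<close> is not longer than \<open>w\<close> and
    represents the same element; since \<open>w\<close> is reduced, the lengths agree.\<close>
  have "v = w" using v w reducedD cox_eq.sym by (metis le_antisym)
  obtain u where u: "w @ [j] \<equiv>\<^sub>W u" "length u < length (w @ [j])"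
    using assms wI by (auto simp: reduced_word_def not_le)
  have s: "pr [] \<in> states" using irr_Nil by (auto simp: states_def)
  obtain u' where u': "u' \<in> lists I" "pr u' = fold act u (pr [])" "length u' \<le> length u"
    using normal_form[of u] cox_eq_lists u by metis
  have "final j (pr w)"
  proof (rule ccontr)
    assume "\<not> final j (pr w)"
    then have "pr (w @ [j]) = fold act (w @ [j]) (pr [])"
      using act_pr_not_final[of j w] v(3) unfolding \<open>v = w\<close> by simp
    then have "pr (w @ [j]) = pr u'" using fold_act_cox[OF u(1) s] u' by simp
    then have "length (w @ [j]) = length u'" by (rule pr_eq_length) (use u' wI j in auto)
    then show False using u u' by simp
  qed
  then show ?thesis using pr_final_iff[OF wI j] that by blast
qed

lemma reduced_Nil: "reduced []"
  by (simp add: reduced_word_def)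

lemma reduced_singleton: "j \<in> I \<Longrightarrow> reduced [j]"
  using reduced_snoc_fails[OF reduced_Nil] by force

lemma reduced_pair:
  assumes "j \<in> I" "k \<in> I" "j \<noteq> k"
  shows "reduced [j, k]"
proof (rule ccontr)
  assume "\<not> reduced [j, k]"
  then have "\<not> reduced ([j] @ [k])" by simp
  then obtain a b where "[j] = a @ k # b"
    using reduced_snoc_fails[OF reduced_singleton] assms by metis
  then show False using assms by (cases a) auto
qed

lemma reduced_cox: "reduced u \<Longrightarrow> u \<equiv>\<^sub>W v \<Longrightarrow> length u = length v \<Longrightarrow> reduced v"
  unfolding reduced_word_def using cox_eq_lists cox_eq.trans by metis

lemma reduced_length_eq: "reduced u \<Longrightarrow> reduced v \<Longrightarrow> u \<equiv>\<^sub>W v \<Longrightarrow> length u = length v"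
  by (intro le_antisym reducedD(2)) (auto intro: cox_eq.sym)

lemma reduced_butlast:
  assumes "reduced (u @ v)"
  shows "reduced u"
proof -
  have l: "u \<in> lists I" "v \<in> lists I" using assms reducedD(1) by fastforce+
  have "length u \<le> length u'" if "u \<equiv>\<^sub>W u'" for u'
    using reducedD(2)[OF assms, of "u' @ v"] cox_eq_context[OF that, of "[]" v] l by simp
  then show ?thesis using l by (simp add: reduced_word_def)
qed

text \<open>By parity a representative \<open>v\<close> of \<open>w @ [j]\<close> that is shorter
  than this word is even shorter than \<open>w\<close>; then \<open>v @ [j]\<close> represents
  \<open>w\<close> and has minimal length.\<close>

lemma reduced_snoc_cases:
  assumes w: "reduced w" and j: "j \<in> I" and n: "\<not> reduced (w @ [j])"
  obtains v where "reduced (v @ [j])" "w \<equiv>\<^sub>W v @ [j]" "length w = length v + 1"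
proof -
  obtain v where v: "w @ [j] \<equiv>\<^sub>W v" "length v < length (w @ [j])"
    using assms reducedD(1)[OF w] by (auto simp: reduced_word_def not_le)
  have wI: "w \<in> lists I" using w reducedD by blast
  have "length v \<noteq> length w" using cox_eq_parity[OF v(1)] by auto
  then have l: "length v + 1 \<le> length w" using v by simp
  have "w @ [j, j] @ [] \<equiv>\<^sub>W w @ []" using wI j by (intro cox_cancel) auto
  moreover have "(w @ [j]) @ [j] \<equiv>\<^sub>W v @ [j]"
    using cox_eq_context[OF v(1), of "[]" "[j]"] j by simp
  ultimately have e: "w \<equiv>\<^sub>W v @ [j]" by (simp, meson cox_eq.sym cox_eq.trans)
  then have "length w = length v + 1" using reducedD(2)[OF w e] l by simp
  then show ?thesis using that e reduced_cox[OF w e] by simp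
qed

text \<open>Both \<open>j\<close> and \<open>k\<close> have an occurrence in \<open>w\<close> that
  can be commuted to the end; \<open>t\<close> is what remains after deleting these two
  occurrences.\<close>

lemma reduced_two_descents:
  assumes w: "reduced w" and "j \<in> I" "k \<in> I" "j \<noteq> k"
    and "\<not> reduced (w @ [j])" "\<not> reduced (w @ [k])"
  obtains t where "M j k = 2" "w \<equiv>\<^sub>W t @ [j, k]" "w \<equiv>\<^sub>W t @ [k, j]" "length w = length t + 2"
proof -
  have wI: "w \<in> lists I" using w reducedD by blast
  \<comment> \<open>This is the case where the occurrence of \<open>k\<close> stands before that of
    \<open>j\<close>: then \<open>k\<close> has to move past \<open>j\<close>, which forces
    \<open>M j k = 2\<close>. The other case is symmetric.\<close>
  have main: "\<exists>t. M j k = 2 \<and> w \<equiv>\<^sub>W t @ [j, k] \<and> length w = length t + 2"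
    if jk: "j \<in> I" "k \<in> I" "j \<noteq> k"
      and 1: "w = a @ j # b" "\<forall>x\<in>set b. \<not> nc j x"
      and 2: "w = c @ k # d" "\<forall>x\<in>set d. \<not> nc k x" and l: "length c < length a"
    for j k a b c d
  proof -
    obtain e where e: "a = c @ k # e" "d = e @ j # b"
    proof -
      have "c @ k # d = a @ j # b" using 1 2 by simp
      then obtain us where "c = a @ us \<or> c @ us = a \<and> k # d = us @ j # b"
        by (auto simp: append_eq_append_conv2)
      then have us: "a = c @ us" "k # d = us @ j # b" "us \<noteq> []" using l by auto
      then obtain e where "us = k # e" by (cases us) auto
      then show ?thesis using that us by auto
    qed
    have ld: "c \<in> lists I" "e \<in> lists I" "b \<in> lists I" using wI 1 e by auto
    have "M j k = 2" using not_nc[of j k] jk 2 e nc_sym by auto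
    have "w \<equiv>\<^sub>W (c @ e @ j # b) @ [k]"
      using cox_move[of c d k] 2 e ld jk by simp
    moreover have "(c @ e @ j # b) @ [k] \<equiv>\<^sub>W (c @ e @ b @ [j]) @ [k]"
      using cox_eq_context[OF cox_move[of "c @ e" b j], of "[]" "[k]"] 1 ld jk by simp
    ultimately have "w \<equiv>\<^sub>W (c @ e @ b) @ [j, k]" by (simp, meson cox_eq.trans)
    then show ?thesis using \<open>M j k = 2\<close> 1 e by (intro exI[of _ "c @ e @ b"]) auto
  qed
  obtain a b where 1: "w = a @ j # b" "\<forall>x\<in>set b. \<not> nc j x"
    using reduced_snoc_fails assms by metis
  obtain c d where 2: "w = c @ k # d" "\<forall>x\<in>set d. \<not> nc k x"
    using reduced_snoc_fails assms by metis
  have "length a \<noteq> length c"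
    using 1(1) 2(1) assms by (metis append_eq_append_conv list.inject)
  then consider "length c < length a" | "length a < length c" by linarith
  then have "\<exists>t. M j k = 2 \<and> (w \<equiv>\<^sub>W t @ [j, k] \<or> w \<equiv>\<^sub>W t @ [k, j]) \<and> length w = length t + 2"
  proof cases
    case 1
    then show ?thesis using main[of j k a b c d] \<open>w = a @ j # b\<close> \<open>\<forall>x\<in>set b. \<not> nc j x\<close> 2 assms by blast
  next
    case l: 2
    then show ?thesis using main[of k j c d a b] 1 2 assms M_sym by metis
  qed
  then obtain t where t: "M j k = 2" "w \<equiv>\<^sub>W t @ [j, k] \<or> w \<equiv>\<^sub>W t @ [k, j]" "length w = length t + 2"
    by blast
  have "t \<in> lists I" using t cox_eq_lists(2) by fastforce
  then have "t @ [j, k] @ [] \<equiv>\<^sub>W t @ [k, j] @ []" using cox_swap t assms by blast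
  then have "w \<equiv>\<^sub>W t @ [j, k]" "w \<equiv>\<^sub>W t @ [k, j]"
    using t by (auto intro: cox_eq.trans cox_eq.sym)
  then show ?thesis using that t by blast
qed

end

section \<open>Galleries and gates in right-angled buildings\<close>

lemma gallery_append:
  "gallery \<Delta> (u @ v) x y \<longleftrightarrow> (\<exists>z. gallery \<Delta> u x z \<and> gallery \<Delta> v z y)"
  by (induction u arbitrary: x) auto

lemma gallery_snoc:
  "gallery \<Delta> (w @ [j]) x y \<longleftrightarrow> (\<exists>z. gallery \<Delta> w x z \<and> (z, y) \<in> adj \<Delta> j \<and> z \<noteq> y)"
  by (auto simp: gallery_append)

locale rab = racg "types \<Delta>" M
  for \<Delta> :: "('i, 'a) chamber_system" and M +
  fixes \<delta>
  assumes chamber_system: "is_chamber_system \<Delta>" and weyl: "weyl_distance M \<Delta> \<delta>"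
begin

notation cox (infix "\<equiv>\<^sub>W" 50)

abbreviation I where "I \<equiv> types \<Delta>"
abbreviation C where "C \<equiv> chambers \<Delta>"
abbreviation A where "A \<equiv> adj \<Delta>"

lemma adj_equiv: "j \<in> I \<Longrightarrow> equiv C (A j)"
  using chamber_system by (simp add: is_chamber_system_def)

lemma adj_refl: "j \<in> I \<Longrightarrow> x \<in> C \<Longrightarrow> (x, x) \<in> A j"
  using adj_equiv by (meson equivE refl_onD)

lemma adj_sym: "j \<in> I \<Longrightarrow> (x, y) \<in> A j \<Longrightarrow> (y, x) \<in> A j"
  using adj_equiv by (meson equivE symD)

lemma adj_trans: "j \<in> I \<Longrightarrow> (x, y) \<in> A j \<Longrightarrow> (y, z) \<in> A j \<Longrightarrow> (x, z) \<in> A j"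
  using adj_equiv by (meson equivE transD)

lemma adj_chambers: "j \<in> I \<Longrightarrow> (x, y) \<in> A j \<Longrightarrow> x \<in> C \<and> y \<in> C"
  using adj_equiv[of j] by (auto simp: equiv_def)

lemma gallery_chambers: "w \<in> lists I \<Longrightarrow> gallery \<Delta> w x y \<Longrightarrow> x \<in> C \<Longrightarrow> y \<in> C"
  by (induction w arbitrary: x) (auto dest: adj_chambers)

lemma cox_elt_eq_iff:
  assumes "u \<in> lists I" "v \<in> lists I"
  shows "cox_elt I M u = cox_elt I M v \<longleftrightarrow> u \<equiv>\<^sub>W v"
proof
  assume "cox_elt I M u = cox_elt I M v"
  moreover have "v \<in> cox_elt I M v" using assms by (simp add: cox_elt_def cox_rel_def cox_eq.refl)
  ultimately have "v \<in> cox_elt I M u" by simp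
  then show "u \<equiv>\<^sub>W v" by (simp add: cox_elt_def cox_rel_def)
next
  assume "u \<equiv>\<^sub>W v"
  then have "u \<equiv>\<^sub>W w \<longleftrightarrow> v \<equiv>\<^sub>W w" for w by (meson cox_eq.sym cox_eq.trans)
  then show "cox_elt I M u = cox_elt I M v" by (auto simp: cox_elt_def cox_rel_def)
qed

lemma weylD:
  assumes "x \<in> C" "y \<in> C"
  shows "\<delta> x y \<in> coxeter_group I M"
    and "reduced w \<Longrightarrow> \<delta> x y = cox_elt I M w \<longleftrightarrow> gallery \<Delta> w x y"
  using weyl assms by (auto simp: weyl_distance_def)

lemma ex_reduced_gallery:
  assumes "x \<in> C" "y \<in> C"
  obtains w where "reduced w" "gallery \<Delta> w x y"
proof -
  obtain u where u: "u \<in> lists I" "\<delta> x y = cox_elt I M u"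
    using weylD(1)[OF assms] by (auto simp: coxeter_group_def quotient_def cox_elt_def)
  obtain w where w: "u \<equiv>\<^sub>W w" "\<And>v. u \<equiv>\<^sub>W v \<Longrightarrow> length w \<le> length v"
    using ex_has_least_nat[of "\<lambda>v. u \<equiv>\<^sub>W v" u length] cox_eq.refl[OF u(1)] by blast
  have "reduced w"
    using w cox_eq_lists(2)[OF w(1)] cox_eq.trans[OF w(1)] by (auto simp: reduced_word_def)
  moreover have "\<delta> x y = cox_elt I M w"
    using u w cox_elt_eq_iff cox_eq_lists by metis
  ultimately show ?thesis using that weylD(2)[OF assms] by blast
qed

lemma gallery_cox_iff:
  assumes "x \<in> C" "y \<in> C" "reduced u" "reduced v" "gallery \<Delta> u x y"
  shows "gallery \<Delta> v x y \<longleftrightarrow> u \<equiv>\<^sub>W v"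
  using weylD(2)[OF assms(1,2)] assms cox_elt_eq_iff reducedD(1) by metis

text \<open>The gallery from \<open>a\<close> over \<open>z\<close> to \<open>b\<close> has type
  \<open>[k, j]\<close>, which represents the same element as \<open>[j, k]\<close>. The Weyl
  distance therefore yields a gallery of type \<open>[j, k]\<close>, whose middle chamber is the
  fourth corner \<open>d\<close>; the degenerate squares are treated first.\<close>

lemma adj_commute:
  assumes "j \<in> I" "k \<in> I" "M j k = 2" "(z, a) \<in> A k" "(z, b) \<in> A j"
  obtains d where "(a, d) \<in> A j" "(b, d) \<in> A k"
proof (cases "a = z \<or> b = z")
  case True
  then show ?thesis
  proof
    assume "a = z"
    then show ?thesis using that[of b] assms adj_refl adj_chambers by blast
  next
    assume "b = z"
    then show ?thesis using that[of a] assms adj_refl adj_chambers by blast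
  qed
next
  case False
  have ne: "j \<noteq> k" using assms M_diag by (auto simp: numeral_eq_enat one_enat_def)
  have "gallery \<Delta> [k, j] a' b'" if "(a', z') \<in> A k" "a' \<noteq> z'" "(z', b') \<in> A j" "z' \<noteq> b'" for a' b' z'
    using that by auto
  then have g: "gallery \<Delta> [k, j] a b" using assms False adj_sym by blast
  have ab: "a \<in> C" "b \<in> C" using assms adj_chambers by blast+
  have "[] @ [j, k] @ [] \<equiv>\<^sub>W [] @ [k, j] @ []" using assms by (intro cox_swap) auto
  then have "[k, j] \<equiv>\<^sub>W [j, k]" by (simp add: cox_eq.sym)
  then have "gallery \<Delta> [j, k] a b"
    using gallery_cox_iff[OF ab _ _ g] reduced_pair assms ne by metis
  then obtain d where "(a, d) \<in> A j" "(d, b) \<in> A k" by auto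
  then show ?thesis using that assms adj_sym by blast
qed

text \<open>The choice is harmless: the types of all reduced galleries from \<open>c\<close> to
  \<open>x\<close> represent one element and so have equal length.\<close>

definition dist_from :: "'a \<Rightarrow> 'a \<Rightarrow> nat" where
  "dist_from c x = length (SOME w. reduced w \<and> gallery \<Delta> w c x)"

lemma dist_from_eq:
  assumes "c \<in> C" "x \<in> C" "reduced w" "gallery \<Delta> w c x"
  shows "dist_from c x = length w"
proof -
  let ?u = "SOME w. reduced w \<and> gallery \<Delta> w c x"
  have u: "reduced ?u \<and> gallery \<Delta> ?u c x" by (rule someI[of _ w]) (use assms in blast)
  then have "w \<equiv>\<^sub>W ?u" using gallery_cox_iff assms by blast
  then have "length w = length ?u" using u assms(3) reduced_length_eq by blast
  then show ?thesis by (simp add: dist_from_def)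
qed

end

section \<open>Gates of panels with respect to a base chamber\<close>

locale pointed_rab = rab \<Delta> M \<delta>
  for \<Delta> :: "('i, 'a) chamber_system" and M \<delta> +
  fixes c :: 'a
  assumes base: "c \<in> C"
begin

definition len where "len x = dist_from c x"

lemma len_eq: "x \<in> C \<Longrightarrow> reduced w \<Longrightarrow> gallery \<Delta> w c x \<Longrightarrow> len x = length w"
  using dist_from_eq base by (simp add: len_def)

text \<open>If \<open>w @ [j]\<close> is reduced, \<open>x\<close> itself is nearest to
  \<open>c\<close>. Otherwise \<open>x\<close> is reached by a gallery of a reduced type ending in
  \<open>j\<close>, and its penultimate chamber is nearest.\<close>

lemma ex_gate:
  assumes x: "x \<in> C" and j: "j \<in> I"
  shows "\<exists>y. (x, y) \<in> A j \<and> (\<forall>z. (x, z) \<in> A j \<longrightarrow> z \<noteq> y \<longrightarrow> len z = len y + 1)"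
proof -
  obtain w where w: "reduced w" "gallery \<Delta> w c x" using ex_reduced_gallery base x by blast
  have *: "len z = len y + 1"
    if "reduced (v @ [j])" "gallery \<Delta> v c y" "y \<in> C" "(y, z) \<in> A j" "z \<noteq> y" for v y z
  proof -
    have "gallery \<Delta> (v @ [j]) c z" using that by (auto simp: gallery_snoc)
    then show ?thesis using len_eq that reduced_butlast adj_chambers[OF j] by fastforce
  qed
  show ?thesis
  proof (cases "reduced (w @ [j])")
    case True
    then show ?thesis using *[of w x] w x adj_refl j by blast
  next
    case False
    then obtain v where v: "reduced (v @ [j])" "w \<equiv>\<^sub>W v @ [j]"
      using reduced_snoc_cases[OF w(1) j] by metis
    then have "gallery \<Delta> (v @ [j]) c x" using gallery_cox_iff base x w by blast
    then obtain y where y: "gallery \<Delta> v c y" "(y, x) \<in> A j" by (auto simp: gallery_snoc)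
    have "y \<in> C" using y adj_chambers j by blast
    then show ?thesis using *[OF v(1) y(1)] y j adj_sym adj_trans by (intro exI[of _ y]) blast
  qed
qed

text \<open>The projection of the base chamber \<open>c\<close> to the \<open>j\<close>-panel of
  \<open>x\<close>.\<close>

definition gate :: "_ \<Rightarrow> _ \<Rightarrow> _" where
  "gate j x = (SOME y. (x, y) \<in> A j \<and> (\<forall>z. (x, z) \<in> A j \<longrightarrow> z \<noteq> y \<longrightarrow> len z = len y + 1))"

lemma gate:
  assumes "x \<in> C" "j \<in> I"
  shows gate_adj: "(x, gate j x) \<in> A j"
    and gate_len: "(x, z) \<in> A j \<Longrightarrow> z \<noteq> gate j x \<Longrightarrow> len z = len (gate j x) + 1"
  using someI_ex[OF ex_gate[OF assms]] unfolding gate_def[symmetric] by blast+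

lemma gate_chamber: "x \<in> C \<Longrightarrow> j \<in> I \<Longrightarrow> gate j x \<in> C"
  using gate_adj adj_chambers by blast

lemma gate_eqI:
  assumes "x \<in> C" "j \<in> I" "(x, y) \<in> A j" "len y \<le> len (gate j x)"
  shows "gate j x = y"
proof (rule ccontr)
  assume "gate j x \<noteq> y"
  then have "len y = len (gate j x) + 1" using gate_len[OF assms(1-3)] by simp
  then show False using assms(4) by simp
qed

lemma gate_le: "x \<in> C \<Longrightarrow> j \<in> I \<Longrightarrow> (x, y) \<in> A j \<Longrightarrow> len (gate j x) \<le> len y"
  using gate_len[of x j y] by (cases "y = gate j x") auto

lemma gate_cong:
  assumes "j \<in> I" "(x, y) \<in> A j"
  shows "gate j x = gate j y"
proof (rule gate_eqI)
  have C: "x \<in> C" "y \<in> C" using assms adj_chambers by auto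
  show "(x, gate j y) \<in> A j" using assms gate_adj C adj_trans by blast
  show "len (gate j y) \<le> len (gate j x)"
    using assms gate_adj C adj_trans adj_sym by (intro gate_le) blast+
qed (use assms adj_chambers in blast)+

abbreviation down :: "_ \<Rightarrow> _ \<Rightarrow> bool" where
  "down j x \<equiv> gate j x \<noteq> x"

lemma down_len: "x \<in> C \<Longrightarrow> j \<in> I \<Longrightarrow> down j x \<Longrightarrow> len x = len (gate j x) + 1"
  using gate_len adj_refl by metis

lemma len_less_gate:
  assumes "x \<in> C" "j \<in> I" "(x, y) \<in> A j" "len y < len x"
  shows "gate j x = y" "down j x"
proof -
  have "down j x" using gate_le[OF assms(1-3)] assms(4) by auto
  then have "len x = len (gate j x) + 1" using down_len assms by blast
  then show "gate j x = y" using gate_eqI[OF assms(1-3)] assms(4) by simp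
  show "down j x" by fact
qed

lemma len_adj:
  assumes "j \<in> I" "(x, y) \<in> A j"
  shows "len y \<le> len x + 1"
proof -
  have "x \<in> C" using assms adj_chambers by blast
  then show ?thesis
    using gate_len[of x j y] gate_le[of x j x] adj_refl[of j x] assms
    by (cases "y = gate j x") auto
qed

lemma len_base: "len c = 0"
  using len_eq[OF base reduced_Nil] by simp

lemma ex_down:
  assumes "x \<in> C" "x \<noteq> c"
  obtains j where "j \<in> I" "down j x"
proof -
  obtain w where w: "reduced w" "gallery \<Delta> w c x" using ex_reduced_gallery base assms by blast
  obtain v j where v: "w = v @ [j]" using w assms by (cases w rule: rev_cases) auto
  then obtain y where y: "gallery \<Delta> v c y" "(y, x) \<in> A j" using w by (auto simp: gallery_snoc)
  have j: "j \<in> I" using reducedD(1)[OF w(1)] v by simp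
  have "y \<in> C" using y adj_chambers j by blast
  then have "len y < len x" using len_eq w v y assms reduced_butlast by fastforce
  then have "down j x" using len_less_gate[of x j y] assms y j adj_sym by blast
  then show ?thesis using that j by blast
qed

lemma base_not_down: "j \<in> I \<Longrightarrow> \<not> down j c"
  using down_len[OF base] len_base by fastforce

lemma down_not_reduced:
  assumes "x \<in> C" "j \<in> I" "down j x" "reduced w" "gallery \<Delta> w c x"
  shows "\<not> reduced (w @ [j])"
proof
  assume r: "reduced (w @ [j])"
  have "gallery \<Delta> (w @ [j]) c (gate j x)" using assms gate_adj by (auto simp: gallery_snoc)
  then have "len (gate j x) = length w + 1" using len_eq r gate_chamber assms by fastforce
  then show False using len_eq[OF assms(1,4,5)] down_len[OF assms(1-3)] by simp
qed

text \<open>Two descents of \<open>x\<close> give a reduced type ending in \<open>[j, k]\<close> as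
  well as in \<open>[k, j]\<close> after a common part \<open>t\<close>. The chamber
  \<open>z\<close> reached after \<open>t\<close> is the bottom of a square with top
  \<open>x\<close>.\<close>

lemma diamond:
  assumes x: "x \<in> C" and "j \<in> I" "k \<in> I" "j \<noteq> k" "down j x" "down k x"
  shows "M j k = 2" "gate k (gate j x) = gate j (gate k x)" "down k (gate j x)"
proof -
  obtain w where w: "reduced w" "gallery \<Delta> w c x" using ex_reduced_gallery base x by blast
  obtain t where t: "M j k = 2" "w \<equiv>\<^sub>W t @ [j, k]" "w \<equiv>\<^sub>W t @ [k, j]" "length w = length t + 2"
    using reduced_two_descents[of w j k] down_not_reduced assms w by metis
  show "M j k = 2" by fact
  have r: "reduced (t @ [j, k])" "reduced (t @ [k, j])" using reduced_cox w t by force+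
  then have rt: "reduced t" "reduced (t @ [j])" "reduced (t @ [k])"
    using reduced_butlast[of "t @ [j]" "[k]"] reduced_butlast[of "t @ [k]" "[j]"]
      reduced_butlast[of t] by auto
  have "gallery \<Delta> (t @ [k, j]) c x" using gallery_cox_iff base x w r t by blast
  then obtain z where z: "gallery \<Delta> t c z" "gallery \<Delta> [k, j] z x"
    by (auto simp: gallery_append)
  have zC: "z \<in> C" using gallery_chambers z reducedD(1) rt base by blast
  have "[] @ [j, k] @ [] \<equiv>\<^sub>W [] @ [k, j] @ []" using assms t by (intro cox_swap) auto
  then have sw: "[k, j] \<equiv>\<^sub>W [j, k]" by (simp add: cox_eq.sym)
  have z': "gallery \<Delta> [j, k] z x"
    using gallery_cox_iff[OF zC x _ _ z(2)] reduced_pair assms sw by metis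
  have lx: "len x = length t + 2" and lz: "len z = length t"
    using len_eq[OF x w] t len_eq[OF zC rt(1) z(1)] by auto
  \<comment> \<open>Here \<open>a\<close>, \<open>b\<close> stands for either order of
    \<open>j\<close>, \<open>k\<close>. The lengths \<open>length t\<close>,
    \<open>length t + 1\<close>, \<open>length t + 2\<close> along the gallery make each predecessor
    the gate of its successor.\<close>
  have *: "gate b x = y \<and> gate a y = z \<and> down a y"
    if "a \<in> I" "b \<in> I" "reduced (t @ [a])" "(z, y) \<in> A a" "z \<noteq> y" "(y, x) \<in> A b" for a b y
  proof -
    have y: "y \<in> C" using that adj_chambers by blast
    have "gallery \<Delta> (t @ [a]) c y" using that z by (auto simp: gallery_snoc)
    then have ly: "len y = length t + 1" using len_eq[OF y that(3)] by simp
    have "gate b x = y" using that lx ly adj_sym x by (intro len_less_gate) auto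
    moreover have "gate a y = z" using that lz ly adj_sym y by (intro len_less_gate) auto
    moreover have "down a y" using that lz ly adj_sym y by (intro len_less_gate(2)[of y a z]) auto
    ultimately show ?thesis by simp
  qed
  obtain y where "(z, y) \<in> A k" "z \<noteq> y" "(y, x) \<in> A j" using z by auto
  then have 1: "gate j x = y \<and> gate k y = z \<and> down k y" using * assms rt by blast
  obtain y' where "(z, y') \<in> A j" "z \<noteq> y'" "(y', x) \<in> A k" using z' by auto
  then have 2: "gate k x = y' \<and> gate j y' = z \<and> down j y'" using * assms rt by blast
  show "gate k (gate j x) = gate j (gate k x)" "down k (gate j x)" using 1 2 by auto
qed

text \<open>Compare \<open>x\<close> and \<open>y\<close> with the common gate \<open>u\<close> of
  their \<open>k\<close>-panel. If \<open>i\<close> were a descent of \<open>u\<close>, completing a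
  square would give a chamber in the \<open>i\<close>-panel of \<open>x\<close> nearer to
  \<open>c\<close> than \<open>x\<close>; if not, \<open>diamond\<close> excludes that
  \<open>i\<close> is a descent of \<open>y\<close>.\<close>

lemma gate_parallel:
  assumes "i \<in> I" "k \<in> I" "M i k = 2" "(x, y) \<in> A k" "gate i x = x"
  shows "gate i y = y"
proof (rule ccontr)
  assume dy: "down i y"
  have C: "x \<in> C" "y \<in> C" using assms adj_chambers by blast+
  have ne: "i \<noteq> k" using assms M_diag by (auto simp: numeral_eq_enat one_enat_def)
  define u where "u = gate k x"
  have uy: "u = gate k y" using gate_cong assms u_def by blast
  have uC: "u \<in> C" using gate_chamber u_def C assms by blast
  have "gate i u = u"
  proof (rule ccontr)
    assume du: "down i u"
    then have "down k x" using assms u_def by auto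
    then have lx: "len x = len u + 1" using down_len C assms u_def by blast
    have lu: "len u = len (gate i u) + 1" using down_len du uC assms by blast
    obtain d where d: "(x, d) \<in> A i" "(gate i u, d) \<in> A k"
      using adj_commute[OF assms(1-3), of u x "gate i u"] gate_adj C uC assms adj_sym u_def by metis
    then have "len d < len x" using len_adj[OF assms(2) d(2)] lx lu by simp
    then show False using len_less_gate(2)[of x i d] d C assms by blast
  qed
  moreover have "down i (gate k y)" if "down k y"
    using diamond(3)[of y k i] that dy C assms ne by auto
  ultimately show False using dy uy by metis
qed

section \<open>Recursion along gates\<close>

function along :: "('i \<Rightarrow> 'a \<Rightarrow> 'b \<Rightarrow> 'b) \<Rightarrow> 'b \<Rightarrow> 'a \<Rightarrow> 'b" where
  "along s b0 x = (if x \<in> C \<and> x \<noteq> c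
     then let j = SOME j. j \<in> I \<and> down j x in s j x (along s b0 (gate j x)) else b0)"
  by pat_completeness auto
termination
proof (relation "Wellfounded.measure (\<lambda>(s, b0, x). len x)")
  fix s :: "'i \<Rightarrow> 'a \<Rightarrow> 'b \<Rightarrow> 'b" and b0 x j
  assume x: "x \<in> C \<and> x \<noteq> c" and j: "j = (SOME j. j \<in> I \<and> down j x)"
  have "j \<in> I \<and> down j x" unfolding j by (rule someI_ex) (use x ex_down in blast)
  then have "len (gate j x) < len x" using down_len x by fastforce
  then show "((s, b0, gate j x), s, b0, x) \<in> Wellfounded.measure (\<lambda>(s, b0, x). len x)" by simp
qed simp

declare along.simps [simp del]

text \<open>The function \<open>along\<close> follows an arbitrarily chosen descent. As in Newman's
  lemma, confluence on the squares of \<open>diamond\<close> makes the value independent of that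
  choice, so the recursion equation holds for every descent.\<close>

lemma recursion_along_gates:
  assumes base_inv: "Inv c b0"
    and step: "\<And>j x b. j \<in> I \<Longrightarrow> x \<in> C \<Longrightarrow> down j x \<Longrightarrow> Inv (gate j x) b \<Longrightarrow> Inv x (s j x b)"
    and confl: "\<And>j k x b. \<lbrakk>j \<in> I; k \<in> I; j \<noteq> k; x \<in> C; down j x; down k x;
        Inv (gate k (gate j x)) b\<rbrakk>
      \<Longrightarrow> s j x (s k (gate j x) b) = s k x (s j (gate k x) b)"
  obtains f where "f c = b0" "\<And>x. x \<in> C \<Longrightarrow> Inv x (f x)"
    "\<And>x j. x \<in> C \<Longrightarrow> j \<in> I \<Longrightarrow> down j x \<Longrightarrow> f x = s j x (f (gate j x))"
proof -
  let ?f = "along s b0"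
  have c: "?f c = b0" by (simp add: along.simps)
  have "Inv x (?f x) \<and> (\<forall>j\<in>I. down j x \<longrightarrow> ?f x = s j x (?f (gate j x)))" if "x \<in> C" for x
    using that
  proof (induction "len x" arbitrary: x rule: less_induct)
    case less
    show ?case
    proof (cases "x = c")
      case True
      then show ?thesis using c base_inv base_not_down by auto
    next
      case False
      define j where "j = (SOME j. j \<in> I \<and> down j x)"
      have j: "j \<in> I \<and> down j x" unfolding j_def by (rule someI_ex) (use less False ex_down in blast)
      have fx: "?f x = s j x (?f (gate j x))"
        using less False by (simp add: along.simps[of _ _ x] j_def Let_def)
      have IH: "Inv (gate k x) (?f (gate k x)) \<and>
          (\<forall>j\<in>I. down j (gate k x) \<longrightarrow> ?f (gate k x) = s j (gate k x) (?f (gate j (gate k x))))"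
        if "k \<in> I" "down k x" for k
        using less that down_len gate_chamber by auto
      have "?f x = s k x (?f (gate k x))" if k: "k \<in> I" "down k x" for k
      proof (cases "j = k")
        case True
        then show ?thesis using fx by simp
      next
        case False
        note d = diamond[OF less.prems _ k(1) False _ k(2)] diamond[OF less.prems k(1) _ _ k(2), of j]
        \<comment> \<open>The bottom of the square below \<open>x\<close>: the values at both gates
          are computed from the value at \<open>z\<close>, where \<open>confl\<close>
          applies.\<close>
        define z where "z = gate k (gate j x)"
        have z: "z = gate j (gate k x)" "down k (gate j x)" "down j (gate k x)"
          using d j False z_def by auto
        have gC: "gate j x \<in> C" using gate_chamber j less by blast
        have "len z < len x"
          using down_len[OF gC k(1) z(2)] down_len[OF less.prems] j z_def by fastforce
        moreover have "z \<in> C" using gate_chamber gC k z_def by blast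
        ultimately have "Inv z (?f z)" using less by blast
        then have "s j x (s k (gate j x) (?f z)) = s k x (s j (gate k x) (?f z))"
          using confl[of j k x] j k False less z_def by blast
        moreover have "?f (gate j x) = s k (gate j x) (?f z)" using IH[of j] j k z z_def by auto
        moreover have "?f (gate k x) = s j (gate k x) (?f z)" using IH[of k] j k z by auto
        ultimately show ?thesis using fx by simp
      qed
      moreover have "Inv x (?f x)" using fx step j IH less by metis
      ultimately show ?thesis by blast
    qed
  qed
  then show ?thesis using that[of ?f] c by blast
qed

end

section \<open>Colorings and automorphisms\<close>

context rab
begin

text \<open>The condition on a single component of a legal coloring, expressed by adjacency instead
  of panels, so that components can be replaced one at a time.\<close>

definition coloring :: "'i \<Rightarrow> 'c set \<Rightarrow> ('a \<Rightarrow> 'c) \<Rightarrow> bool" where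
  "coloring i V \<mu> \<longleftrightarrow> (\<forall>x\<in>C. \<mu> x \<in> V) \<and>
     (\<forall>j\<in>I. j \<noteq> i \<longrightarrow> (\<forall>(x, y)\<in>A j. \<mu> x = \<mu> y)) \<and>
     (\<forall>x\<in>C. \<forall>a\<in>V. \<exists>!y. (x, y) \<in> A i \<and> \<mu> y = a)"

lemma coloringD:
  assumes "coloring i V \<mu>"
  shows "x \<in> C \<Longrightarrow> \<mu> x \<in> V"
    and "j \<in> I \<Longrightarrow> j \<noteq> i \<Longrightarrow> (x, y) \<in> A j \<Longrightarrow> \<mu> x = \<mu> y"
    and "x \<in> C \<Longrightarrow> a \<in> V \<Longrightarrow> \<exists>!y. (x, y) \<in> A i \<and> \<mu> y = a"
  using assms by (auto simp: coloring_def)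

lemma coloring_inj:
  assumes "coloring i V \<mu>" "i \<in> I" "(x, y) \<in> A i" "\<mu> x = \<mu> y"
  shows "x = y"
proof -
  have "x \<in> C" using assms adj_chambers by blast
  then have "\<exists>!z. (x, z) \<in> A i \<and> \<mu> z = \<mu> x" using coloringD[OF assms(1)] by blast
  moreover have "(x, x) \<in> A i \<and> \<mu> x = \<mu> x" using \<open>x \<in> C\<close> assms adj_refl by blast
  ultimately show ?thesis using assms by metis
qed

definition transport :: "('a \<Rightarrow> 'c) \<Rightarrow> 'i \<Rightarrow> 'a \<Rightarrow> 'c \<Rightarrow> 'a" where
  "transport \<mu> j y a = (THE z. (y, z) \<in> A j \<and> \<mu> z = a)"

lemma transport:
  assumes "coloring j V \<mu>" "y \<in> C" "a \<in> V"
  shows "(y, transport \<mu> j y a) \<in> A j" "\<mu> (transport \<mu> j y a) = a"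
proof -
  have "(y, transport \<mu> j y a) \<in> A j \<and> \<mu> (transport \<mu> j y a) = a"
    unfolding transport_def by (rule theI') (use coloringD(3)[OF assms(1)] assms in blast)
  then show "(y, transport \<mu> j y a) \<in> A j" "\<mu> (transport \<mu> j y a) = a" by auto
qed

lemma transport_eqI:
  assumes "coloring j V \<mu>" "j \<in> I" "(y, z) \<in> A j"
  shows "transport \<mu> j y (\<mu> z) = z"
proof -
  have "y \<in> C" "\<mu> z \<in> V" using assms coloringD(1)[OF assms(1)] adj_chambers by blast+
  note t = transport[OF assms(1) this]
  then have "(transport \<mu> j y (\<mu> z), z) \<in> A j" using assms adj_sym adj_trans by blast
  then show ?thesis using t coloring_inj[OF assms(1,2)] by blast
qed

end

section \<open>Chamber maps with prescribed colors\<close>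

context pointed_rab
begin

text \<open>The map is built outwards from \<open>c\<close>: the image of \<open>x\<close> is the
  chamber with color \<open>\<mu> j x\<close> in the \<open>j\<close>-panel of the image of
  \<open>gate j x\<close>. Such a step leaves all other colors unchanged, so all colors stay
  correct.\<close>

lemma chamber_map_exists:
  assumes \<mu>: "\<And>i. i \<in> I \<Longrightarrow> coloring i (V i) (\<mu> i)"
    and \<nu>: "\<And>i. i \<in> I \<Longrightarrow> coloring i (V i) (\<nu> i)"
    and d: "d \<in> C" and cd: "\<And>i. i \<in> I \<Longrightarrow> \<mu> i c = \<nu> i d"
  obtains g where "g c = d" "\<And>x. x \<in> C \<Longrightarrow> g x \<in> C"
    "\<And>x i. x \<in> C \<Longrightarrow> i \<in> I \<Longrightarrow> \<nu> i (g x) = \<mu> i x"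
    "\<And>x y i. i \<in> I \<Longrightarrow> (x, y) \<in> A i \<Longrightarrow> (g x, g y) \<in> A i"
proof -
  define s where "s = (\<lambda>j x b. transport (\<nu> j) j b (\<mu> j x))"
  define Inv where "Inv = (\<lambda>x b. b \<in> C \<and> (\<forall>i\<in>I. \<nu> i b = \<mu> i x))"
  have s: "(b, s j x b) \<in> A j" "\<nu> j (s j x b) = \<mu> j x" if "j \<in> I" "x \<in> C" "b \<in> C" for j x b
    using transport[OF \<nu>[OF that(1)]] that coloringD(1)[OF \<mu>[OF that(1)]] by (auto simp: s_def)
  have stp: "Inv x (s j x b)"
    if "j \<in> I" "x \<in> C" "(y, x) \<in> A j" "Inv y b" for j x y b
  proof -
    have b: "b \<in> C" using that by (simp add: Inv_def)
    then have sb: "s j x b \<in> C" using s(1)[OF that(1,2)] adj_chambers that(1) by blast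
    have "\<nu> i (s j x b) = \<mu> i x" if i: "i \<in> I" for i
    proof (cases "i = j")
      case True
      then show ?thesis using s that \<open>x \<in> C\<close> b by simp
    next
      case False
      then have "\<nu> i (s j x b) = \<nu> i b" "\<mu> i y = \<mu> i x"
        using coloringD(2)[OF \<nu>[OF i]] coloringD(2)[OF \<mu>[OF i]] s(1)[of j x b] that b
          \<open>j \<in> I\<close> \<open>x \<in> C\<close> \<open>(y, x) \<in> A j\<close> by metis+
      then show ?thesis using \<open>Inv y b\<close> i by (simp add: Inv_def)
    qed
    then show ?thesis using sb by (simp add: Inv_def)
  qed
  have confl: "s j x (s k (gate j x) b) = s k x (s j (gate k x) b)"
    if a: "j \<in> I" "k \<in> I" "j \<noteq> k" "x \<in> C" "down j x" "down k x"
      and inv: "Inv (gate k (gate j x)) b" for j k x b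
  proof -
    note dj = diamond[OF a(4,1,2,3,5,6)]
    have b: "b \<in> C" using inv by (simp add: Inv_def)
    have gC: "gate j x \<in> C" "gate k x \<in> C" using gate_chamber a by auto
    let ?p = "s k (gate j x) b" and ?q = "s j (gate k x) b"
    note p = s[OF a(2) gC(1) b] and q = s[OF a(1) gC(2) b]
    \<comment> \<open>The fourth corner \<open>e\<close> of the square of images carries both
      prescribed colors, so transporting in either order ends at \<open>e\<close>.\<close>
    obtain e where e: "(?p, e) \<in> A j" "(?q, e) \<in> A k"
      using adj_commute[OF a(1,2) dj(1) p(1) q(1)] by blast
    have "\<nu> j e = \<nu> j ?q" "\<nu> k e = \<nu> k ?p"
      using coloringD(2)[OF \<nu>[OF a(1)] a(2) _ e(2)] coloringD(2)[OF \<nu>[OF a(2)] a(1) _ e(1)] a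
      by auto
    moreover have "\<mu> j (gate k x) = \<mu> j x" "\<mu> k (gate j x) = \<mu> k x"
      using coloringD(2)[OF \<mu>[OF a(1)] a(2) _ gate_adj[OF a(4,2)]]
        coloringD(2)[OF \<mu>[OF a(2)] a(1) _ gate_adj[OF a(4,1)]] a by auto
    ultimately have "\<nu> j e = \<mu> j x" "\<nu> k e = \<mu> k x" using p q by auto
    then show ?thesis
      using transport_eqI[OF \<nu>[OF a(1)] a(1) e(1)] transport_eqI[OF \<nu>[OF a(2)] a(2) e(2)]
      by (simp add: s_def)
  qed
  obtain g where g: "g c = d" "\<And>x. x \<in> C \<Longrightarrow> Inv x (g x)"
    "\<And>x j. x \<in> C \<Longrightarrow> j \<in> I \<Longrightarrow> down j x \<Longrightarrow> g x = s j x (g (gate j x))"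
  proof (rule recursion_along_gates[of Inv d s])
    show "Inv c d" using d cd by (simp add: Inv_def)
    show "Inv x (s j x b)" if "j \<in> I" "x \<in> C" "down j x" "Inv (gate j x) b" for j x b
      using stp[of j x "gate j x" b] that gate_adj adj_sym by blast
  qed (use confl in blast)+
  have gC: "g x \<in> C" "i \<in> I \<Longrightarrow> \<nu> i (g x) = \<mu> i x" if "x \<in> C" for x i
    using g(2)[OF that] by (auto simp: Inv_def)
  \<comment> \<open>All chambers of a panel have the same gate, and the image of each is adjacent to
    the image of that gate; hence adjacency is preserved.\<close>
  have "(g (gate i x), g x) \<in> A i" if "i \<in> I" "x \<in> C" for x i
    using g(3)[of x i] s(1)[of i x "g (gate i x)"] gC gate_chamber that adj_refl
    by (cases "gate i x = x") auto
  then have "(g x, g y) \<in> A i" if "i \<in> I" "(x, y) \<in> A i" for x y i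
    using that adj_chambers gate_cong adj_sym adj_trans by metis
  then show ?thesis using that[of g] g(1) gC by blast
qed

text \<open>By induction outwards, \<open>f x\<close> and \<open>g x\<close> lie in the panel of the
  common image of a gate, and the color decides. Only colors in the ball of radius \<open>n\<close>
  enter, so the lemma also compares maps that differ further out.\<close>

lemma chamber_maps_agree:
  assumes \<nu>: "\<And>i. i \<in> I \<Longrightarrow> coloring i (V i) (\<nu> i)"
    and f: "\<And>x y i. i \<in> I \<Longrightarrow> (x, y) \<in> A i \<Longrightarrow> (f x, f y) \<in> A i"
    and g: "\<And>x y i. i \<in> I \<Longrightarrow> (x, y) \<in> A i \<Longrightarrow> (g x, g y) \<in> A i"
    and c: "f c = g c"
    and col: "\<And>x i. x \<in> C \<Longrightarrow> i \<in> I \<Longrightarrow> len x \<le> n \<Longrightarrow> \<nu> i (f x) = \<nu> i (g x)"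
    and x: "x \<in> C" "len x \<le> n"
  shows "f x = g x"
  using x
proof (induction "len x" arbitrary: x rule: less_induct)
  case less
  show ?case
  proof (cases "x = c")
    case False
    then obtain j where j: "j \<in> I" "down j x" using ex_down less by blast
    then have "f (gate j x) = g (gate j x)"
      using less down_len[of x j] gate_chamber by auto
    moreover have "(f x, f (gate j x)) \<in> A j" "(g x, g (gate j x)) \<in> A j"
      using f g gate_adj less j by blast+
    ultimately have "(f x, g x) \<in> A j" using adj_sym adj_trans j by metis
    then show ?thesis using coloring_inj[OF \<nu>] j col less by blast
  qed (use c in simp)
qed

end

context rab
begin

text \<open>There are color-preserving chamber maps in both directions. Their composites fix the
  base chambers and all colors, so they are identities by \<open>chamber_maps_agree\<close>.\<close>

lemma automorphism_exists:
  assumes c: "c \<in> C" and d: "d \<in> C"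
    and \<mu>: "\<And>i. i \<in> I \<Longrightarrow> coloring i (V i) (\<mu> i)"
    and \<nu>: "\<And>i. i \<in> I \<Longrightarrow> coloring i (V i) (\<nu> i)"
    and cd: "\<And>i. i \<in> I \<Longrightarrow> \<mu> i c = \<nu> i d"
  obtains g where "g \<in> Aut \<Delta>" "g c = d" "\<And>x i. x \<in> C \<Longrightarrow> i \<in> I \<Longrightarrow> \<nu> i (g x) = \<mu> i x"
proof -
  interpret c: pointed_rab \<Delta> M \<delta> c by unfold_locales (rule c)
  interpret d: pointed_rab \<Delta> M \<delta> d by unfold_locales (rule d)
  obtain g where g: "g c = d" "\<And>x. x \<in> C \<Longrightarrow> g x \<in> C"
    "\<And>x i. x \<in> C \<Longrightarrow> i \<in> I \<Longrightarrow> \<nu> i (g x) = \<mu> i x"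
    "\<And>x y i. i \<in> I \<Longrightarrow> (x, y) \<in> A i \<Longrightarrow> (g x, g y) \<in> A i"
    using c.chamber_map_exists[OF \<mu> \<nu> d cd] by blast
  obtain h where h: "h d = c" "\<And>x. x \<in> C \<Longrightarrow> h x \<in> C"
    "\<And>x i. x \<in> C \<Longrightarrow> i \<in> I \<Longrightarrow> \<mu> i (h x) = \<nu> i x"
    "\<And>x y i. i \<in> I \<Longrightarrow> (x, y) \<in> A i \<Longrightarrow> (h x, h y) \<in> A i"
    using d.chamber_map_exists[OF \<nu> \<mu> c cd[symmetric]] by blast
  have hg: "h (g x) = x" if "x \<in> C" for x
    using c.chamber_maps_agree[OF \<mu>, where f="\<lambda>x. h (g x)" and g="\<lambda>x. x" and n="c.len x"] g h that
    by auto
  have gh: "g (h x) = x" if "x \<in> C" for x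
    using d.chamber_maps_agree[OF \<nu>, where f="\<lambda>x. g (h x)" and g="\<lambda>x. x" and n="d.len x"] g h that
    by auto
  have bij: "bij_betw g C C"
    by (rule bij_betw_byWitness[of _ h]) (use hg gh g h in auto)
  let ?g = "restrict g C"
  have "?g \<in> Bij C" using bij by (auto simp: Bij_def cong: bij_betw_cong)
  moreover have "(x, y) \<in> A i \<longleftrightarrow> (?g x, ?g y) \<in> A i" if "i \<in> I" "x \<in> C" "y \<in> C" for i x y
    using g(4)[of i x y] h(4)[of i "g x" "g y"] hg that by auto
  ultimately have "?g \<in> Aut \<Delta>" by (simp add: Aut_def)
  then show ?thesis using that[of ?g] g c by simp
qed

end

section \<open>Recoloring outside a ball\<close>

context rab
begin

definition residue_rel :: "'i set \<Rightarrow> ('a \<times> 'a) set" where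
  "residue_rel J = (\<Union>j\<in>J. A j)\<^sup>*"

lemma residue_rel_sym:
  assumes "J \<subseteq> I" "(x, y) \<in> residue_rel J"
  shows "(y, x) \<in> residue_rel J"
proof -
  have "sym (\<Union>j\<in>J. A j)" using assms(1) adj_sym by (auto simp: sym_def) blast
  then show ?thesis using assms(2) unfolding residue_rel_def by (meson sym_rtrancl symD)
qed

lemma residue_rel_chambers:
  assumes "J \<subseteq> I" "(x, y) \<in> residue_rel J" "x \<in> C"
  shows "y \<in> C"
  using assms(2,3,1) unfolding residue_rel_def
  by (induction rule: rtrancl_induct) (auto dest: adj_chambers)

text \<open>Squares move every \<open>k\<close>-step past the steps of types in \<open>J\<close>, so
  all \<open>k\<close>-steps can be collected into one last step.\<close>

lemma residue_rel_insert:
  assumes J: "J \<subseteq> I" and k: "k \<in> I" and comm: "\<And>j. j \<in> J \<Longrightarrow> j \<noteq> k \<Longrightarrow> M j k = 2"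
    and xy: "(x, y) \<in> residue_rel (insert k J)" and x: "x \<in> C"
  obtains z where "(x, z) \<in> residue_rel J" "(z, y) \<in> A k"
proof -
  have "\<exists>z. (x, z) \<in> residue_rel J \<and> (z, y) \<in> A k"
    using xy unfolding residue_rel_def
  proof (induction rule: rtrancl_induct)
    case base
    then show ?case using adj_refl x k by blast
  next
    case (step y w)
    then obtain z j where z: "(x, z) \<in> (\<Union>j\<in>J. A j)\<^sup>*" "(z, y) \<in> A k"
      and j: "j \<in> insert k J" "(y, w) \<in> A j" by blast
    show ?case
    proof (cases "j = k")
      case True
      then show ?thesis using z j adj_trans k by blast
    next
      case False
      then have "j \<in> J" "j \<in> I" "M j k = 2" using j J comm by auto
      then obtain d where d: "(z, d) \<in> A j" "(w, d) \<in> A k"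
        using adj_commute[of j k y z w] k z j adj_sym by blast
      have "(x, d) \<in> (\<Union>j\<in>J. A j)\<^sup>*"
        using z(1) d(1) \<open>j \<in> J\<close> by (blast intro: rtrancl.rtrancl_into_rtrancl)
      then show ?thesis using d adj_sym k by blast
    qed
  qed
  then show ?thesis using that by blast
qed

text \<open>By \<open>residue_rel_insert\<close>, adding a type \<open>k\<close> enlarges the
  residue at most to the union of the \<open>k\<close>-panels of its chambers.\<close>

lemma finite_commuting_residue:
  assumes fin: "\<And>j x. j \<in> I \<Longrightarrow> x \<in> C \<Longrightarrow> finite (A j `` {x})"
    and J: "finite J" "J \<subseteq> I" and comm: "\<And>j k. j \<in> J \<Longrightarrow> k \<in> J \<Longrightarrow> j \<noteq> k \<Longrightarrow> M j k = 2"
    and x: "x \<in> C"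
  shows "finite (residue_rel J `` {x})"
  using J comm
proof (induction J rule: finite_induct)
  case empty
  then show ?case by (simp add: residue_rel_def)
next
  case (insert k J)
  have "residue_rel (insert k J) `` {x} \<subseteq> (\<Union>z\<in>residue_rel J `` {x}. A k `` {z})"
  proof
    fix y assume "y \<in> residue_rel (insert k J) `` {x}"
    then obtain z where "(x, z) \<in> residue_rel J" "(z, y) \<in> A k"
      using residue_rel_insert[of J k x y thesis] insert.prems x by auto
    then show "y \<in> (\<Union>z\<in>residue_rel J `` {x}. A k `` {z})"
      by blast
  qed
  moreover have "finite (\<Union>z\<in>residue_rel J `` {x}. A k `` {z})"
    using insert fin residue_rel_chambers[of J x] x by auto
  ultimately show ?case using finite_subset by blast
qed

end

section \<open>Modifying one component of a coloring\<close>

context pointed_rab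
begin

lemma finite_ball:
  assumes fin: "\<And>j x. j \<in> I \<Longrightarrow> x \<in> C \<Longrightarrow> finite (A j `` {x})" and "finite I"
  shows "finite {x \<in> C. len x < n}"
proof (induction n)
  case (Suc n)
  let ?B = "insert c (\<Union>y\<in>{x \<in> C. len x < n}. \<Union>j\<in>I. A j `` {y})"
  have "{x \<in> C. len x < Suc n} \<subseteq> ?B"
  proof
    fix x assume x: "x \<in> {x \<in> C. len x < Suc n}"
    show "x \<in> ?B"
    proof (cases "x = c")
      case False
      then obtain j where j: "j \<in> I" "down j x" using ex_down x by blast
      then have "len (gate j x) < n" "gate j x \<in> C" "(gate j x, x) \<in> A j"
        using x down_len[of x j] gate_chamber gate_adj adj_sym by auto
      then show ?thesis using j by blast
    qed simp
  qed
  moreover have "finite ?B" using Suc assms by auto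
  ultimately show ?case using finite_subset by blast
qed simp

text \<open>
  On panels away from the ball, the element of \<open>F\<close> that extends the new coloring from the gate is
  chosen in terms of the two colors of the gate only, so that the choices on parallel panels coincide.
\<close>

lemma recoloring_exists:
  fixes V :: "'c set" and lam \<mu> :: "'a \<Rightarrow> 'c"
  assumes i: "i \<in> I" and lam: "coloring i V lam" and \<mu>: "coloring i V \<mu>"
    and fin: "\<And>j x. j \<in> I \<Longrightarrow> x \<in> C \<Longrightarrow> finite (A j `` {x})" "finite I"
    and comm: "\<And>j k. \<lbrakk>j \<in> I; k \<in> I; M i j = 2; M i k = 2; j \<noteq> k\<rbrakk> \<Longrightarrow> M j k = 2"
    and F: "\<And>\<sigma>. \<sigma> \<in> F \<Longrightarrow> bij_betw \<sigma> V V"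
    and orb: "\<And>x. x \<in> C \<Longrightarrow> \<exists>\<sigma>\<in>F. \<sigma> (lam x) = \<mu> x"
  obtains f N where "coloring i V f" "\<And>x. x \<in> C \<Longrightarrow> len x \<le> n \<Longrightarrow> f x = \<mu> x" "finite N"
    "\<And>x y. x \<in> N \<Longrightarrow> (x, y) \<in> A i \<Longrightarrow> f y = \<mu> y"
    "\<And>x. x \<in> C - N \<Longrightarrow> \<exists>\<sigma>\<in>F. \<forall>y. (x, y) \<in> A i \<longrightarrow> f y = \<sigma> (lam y)"
proof -
  define J where "J = {k\<in>I. M i k = 2}"
  have J: "J \<subseteq> I" "finite J" "i \<notin> J"
    using fin M_diag[OF i] by (auto simp: J_def numeral_eq_enat one_enat_def)
  have Jc: "M j k = 2" if "j \<in> insert i J" "k \<in> insert i J" "j \<noteq> k" for j k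
    using that comm i M_sym by (auto simp: J_def)
  let ?R = "residue_rel (insert i J)"
  have TI: "insert i J \<subseteq> I" using J i by simp
  \<comment> \<open>The union of the residues of type \<open>insert i J\<close> that meet the open
    ball. The strict bound suffices: if \<open>x\<close> lies in the closed ball and
    \<open>i\<close> is a descent of \<open>x\<close>, then \<open>gate i x\<close> has length less
    than \<open>n\<close>.\<close>
  define N where "N = {x\<in>C. \<exists>y\<in>C. (y, x) \<in> ?R \<and> len y < n}"
  have finN: "finite N"
  proof (rule finite_subset)
    show "N \<subseteq> (\<Union>y\<in>{y \<in> C. len y < n}. ?R `` {y})" by (auto simp: N_def)
    have "finite (?R `` {y})" if "y \<in> C" for y
      using fin(1) J(2) TI Jc that by (intro finite_commuting_residue) auto
    then show "finite (\<Union>y\<in>{y \<in> C. len y < n}. ?R `` {y})" using finite_ball fin by auto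
  qed
  have Nstep: "y \<in> N" if "x \<in> N" "j \<in> insert i J" "(x, y) \<in> A j" for x y j
  proof -
    have "(x, y) \<in> (\<Union>j\<in>insert i J. A j)" using that by blast
    then have "(z, y) \<in> ?R" if "(z, x) \<in> ?R" for z
      using that unfolding residue_rel_def by (rule rtrancl.rtrancl_into_rtrancl[rotated])
    moreover have "y \<in> C" using that adj_chambers TI by blast
    ultimately show ?thesis using that by (auto simp: N_def)
  qed
  have Niff: "x \<in> N \<longleftrightarrow> y \<in> N" if "j \<in> insert i J" "(x, y) \<in> A j" for x y j
    using Nstep that adj_sym TI by blast
  define \<tau> where "\<tau> = (\<lambda>a b. SOME \<sigma>. \<sigma> \<in> F \<and> \<sigma> a = b)"
  \<comment> \<open>Every new color stays in the \<open>F\<close>-orbit of the old one, so that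
    \<open>\<tau>\<close> always finds an element to choose.\<close>
  define Inv where "Inv = (\<lambda>x b. \<exists>\<sigma>\<in>F. \<sigma> (lam x) = b)"
  have \<tau>: "\<tau> (lam x) b \<in> F \<and> \<tau> (lam x) b (lam x) = b" if "Inv x b" for x b
    unfolding \<tau>_def by (rule someI_ex[of "\<lambda>\<sigma>. \<sigma> \<in> F \<and> \<sigma> (lam x) = b"]) (use that in \<open>auto simp: Inv_def\<close>)
  define s where "s = (\<lambda>j x b. if j \<noteq> i then b
    else if x \<in> N then \<mu> x else \<tau> (lam (gate i x)) b (lam x))"
  \<comment> \<open>This gives confluence: steps of type other than \<open>i\<close> copy the color,
    and by \<open>diamond\<close> such a descent \<open>k\<close> commutes with \<open>i\<close>, so
    \<open>x\<close> and \<open>gate k x\<close> agree in membership in \<open>N\<close> and in all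
    colors used by \<open>s i\<close>.\<close>
  have si: "s i x b = s i (gate k x) b" if "k \<in> I" "k \<noteq> i" "x \<in> C" "down i x" "down k x" for k x b
  proof -
    note d = diamond[OF that(3) i that(1) that(2)[symmetric] that(4,5)]
    have xk: "(x, gate k x) \<in> A k" and gk: "(gate i x, gate i (gate k x)) \<in> A k"
      using gate_adj that gate_chamber i d(2) by metis+
    have "k \<in> insert i J" using d(1) that by (simp add: J_def)
    then have "x \<in> N \<longleftrightarrow> gate k x \<in> N" using Niff xk by blast
    then show ?thesis
      using coloringD(2)[OF lam that(1,2) xk] coloringD(2)[OF lam that(1,2) gk]
        coloringD(2)[OF \<mu> that(1,2) xk] by (simp add: s_def)
  qed
  have stp: "Inv x (s j x b)" if "j \<in> I" "x \<in> C" "down j x" "Inv (gate j x) b" for j x b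
  proof (cases "j = i")
    case True
    then show ?thesis using orb[OF that(2)] \<tau>[of "gate i x" b] that by (auto simp: s_def Inv_def)
  next
    case False
    then have "lam x = lam (gate j x)" using coloringD(2)[OF lam] gate_adj that by blast
    then show ?thesis using that False by (simp add: s_def Inv_def)
  qed
  have confl: "s j x (s k (gate j x) b) = s k x (s j (gate k x) b)"
    if "j \<in> I" "k \<in> I" "j \<noteq> k" "x \<in> C" "down j x" "down k x" for j k x b
  proof -
    have "s l y b = b" if "l \<noteq> i" for l y b using that by (simp add: s_def)
    then show ?thesis using si[of j x] si[of k x] that by metis
  qed
  obtain f where f: "f c = \<mu> c" "\<And>x. x \<in> C \<Longrightarrow> Inv x (f x)"
    "\<And>x j. x \<in> C \<Longrightarrow> j \<in> I \<Longrightarrow> down j x \<Longrightarrow> f x = s j x (f (gate j x))"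
  proof (rule recursion_along_gates[of Inv "\<mu> c" s])
    show "Inv c (\<mu> c)" using orb base by (simp add: Inv_def)
  qed (use stp confl in blast)+
  have fgate: "f x = f (gate j x)" if "j \<in> I" "j \<noteq> i" "x \<in> C" for j x
    using f(3)[of x j] that by (cases "down j x") (auto simp: s_def)
  have fconst: "f x = f y" if "j \<in> I" "j \<noteq> i" "(x, y) \<in> A j" for j x y
    using fgate[OF that(1,2)] gate_cong that adj_chambers by metis
  have fN: "f x = \<mu> x" if "x \<in> N" "down i x" for x
  proof -
    have "x \<in> C" using that by (simp add: N_def)
    then show ?thesis using f(3)[of x i] that i by (simp add: s_def)
  qed
  have ball: "f x = \<mu> x" if "x \<in> C" "len x \<le> n" for x
    using that
  proof (induction "len x" arbitrary: x rule: less_induct)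
    case less
    show ?case
    proof (cases "x = c")
      case False
      then obtain j where j: "j \<in> I" "down j x" using ex_down less by blast
      let ?g = "gate j x"
      have g: "len x = len ?g + 1" "?g \<in> C" "(?g, x) \<in> A j" "(x, ?g) \<in> A j"
        using j less down_len gate_chamber gate_adj adj_sym by auto
      show ?thesis
      proof (cases "j = i")
        case True
        have "(?g, x) \<in> ?R" using g True unfolding residue_rel_def by blast
        then have "x \<in> N" using g less unfolding N_def by auto
        then show ?thesis using fN j True by blast
      next
        case False
        have "f ?g = \<mu> ?g" using g less by auto
        then show ?thesis
          using fgate[OF j(1) False] coloringD(2)[OF \<mu> j(1) False g(4)] less by simp
      qed
    qed (use f in simp)
  qed
  \<comment> \<open>It remains to treat the gate of an \<open>i\<close>-panel in \<open>N\<close>. A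
    walk with types in \<open>J\<close> leads from it to a chamber \<open>z\<close> in the
    \<open>i\<close>-panel of a ball chamber \<open>y\<close>; along the walk \<open>f\<close>,
    \<open>\<mu>\<close> and being the gate are preserved, so \<open>z\<close> is at most as far out
    as \<open>y\<close> and \<open>ball\<close> applies.\<close>
  have fN': "f x = \<mu> x" if xN: "x \<in> N" for x
  proof (cases "down i x")
    case False
    obtain y where y: "y \<in> C" "(y, x) \<in> ?R" "len y < n" and xC: "x \<in> C"
      using xN by (auto simp: N_def)
    have "(x, y) \<in> ?R" using residue_rel_sym TI y by blast
    then obtain z where z: "(x, z) \<in> residue_rel J" "(z, y) \<in> A i"
      using residue_rel_insert[OF J(1) i _ _ xC] Jc by blast
    have "gate i z = z \<and> f x = f z \<and> \<mu> x = \<mu> z"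
      using z(1) unfolding residue_rel_def
    proof (induction rule: rtrancl_induct)
      case base
      then show ?case using False by simp
    next
      case (step u v)
      then obtain k where k: "k \<in> J" "(u, v) \<in> A k" by blast
      then have "k \<in> I" "k \<noteq> i" "M i k = 2" using J by (auto simp: J_def)
      then show ?case
        using step fconst coloringD(2)[OF \<mu>] gate_parallel[OF i] k by metis
    qed
    moreover have "z \<in> C" using z adj_chambers i by blast
    moreover from calculation have "len z < n" using gate_le[OF _ i z(2)] y by simp
    ultimately show ?thesis using ball[of z] by simp
  qed (use fN xN in blast)
  have act: "\<exists>\<sigma>\<in>F. \<forall>y. (x, y) \<in> A i \<longrightarrow> f y = \<sigma> (lam y)" if x: "x \<in> C - N" for x
  proof -
    let ?z = "gate i x"
    have zC: "?z \<in> C" using gate_chamber x i by blast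
    note t = \<tau>[OF f(2)[OF zC]]
    have "f y = \<tau> (lam ?z) (f ?z) (lam y)" if y: "(x, y) \<in> A i" for y
    proof (cases "y = ?z")
      case True
      then show ?thesis using t by simp
    next
      case False
      have "gate i y = ?z" using gate_cong y i by metis
      moreover have "y \<in> C" "y \<notin> N" using Niff y x i adj_chambers by blast+
      ultimately show ?thesis using f(3)[of y i] False i by (auto simp: s_def)
    qed
    then show ?thesis using t by blast
  qed
  have "coloring i V f"
    unfolding coloring_def
  proof (intro conjI ballI impI)
    fix x assume "x \<in> C"
    then show "f x \<in> V"
      using f(2) coloringD(1)[OF lam] F by (fastforce simp: Inv_def dest: bij_betwE)
  next
    fix j p assume "j \<in> I" "j \<noteq> i" "p \<in> A j"
    then show "case p of (x, y) \<Rightarrow> f x = f y" using fconst by (cases p) blast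
  next
    fix x a assume x: "x \<in> C" and a: "a \<in> V"
    \<comment> \<open>Bijectivity on a panel comes from \<open>\<mu>\<close> inside
      \<open>N\<close>, and from \<open>lam\<close> followed by the permutation
      \<open>\<sigma>\<close> outside.\<close>
    show "\<exists>!y. (x, y) \<in> A i \<and> f y = a"
    proof (cases "x \<in> N")
      case True
      then have "(x, y) \<in> A i \<and> f y = a \<longleftrightarrow> (x, y) \<in> A i \<and> \<mu> y = a" for y
        using Nstep[of x i y] fN'[of y] by auto
      then show ?thesis using coloringD(3)[OF \<mu> x a] by simp
    next
      case False
      then obtain \<sigma> where \<sigma>: "\<sigma> \<in> F" "\<And>y. (x, y) \<in> A i \<Longrightarrow> f y = \<sigma> (lam y)"
        using act x by blast
      obtain a' where a': "a' \<in> V" "\<sigma> a' = a" using F[OF \<sigma>(1)] a by (metis bij_betw_imp_surj_on imageE)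
      have "(x, y) \<in> A i \<and> f y = a \<longleftrightarrow> (x, y) \<in> A i \<and> lam y = a'" for y
      proof -
        have "lam y \<in> V" if "(x, y) \<in> A i" using that adj_chambers i coloringD(1)[OF lam] by blast
        then show ?thesis using \<sigma>(2) a' F[OF \<sigma>(1)] by (metis bij_betw_inv_into_left)
      qed
      then show ?thesis using coloringD(3)[OF lam x a'(1)] by simp
    qed
  qed
  then show ?thesis
  proof (rule that[OF _ ball finN])
    show "f y = \<mu> y" if "x \<in> N" "(x, y) \<in> A i" for x y using that Niff fN' by blast
  qed (use act in auto)
qed

end

section \<open>Local actions and density\<close>

text \<open>As \<open>\<pi>\<close> stabilizes the \<open>F\<close>-orbit of \<open>a\<close>, the
  point \<open>\<pi> a\<close> is reached from \<open>a\<close> by an element of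
  \<open>F\<close>.\<close>

lemma young_overgroup_orbit:
  assumes \<pi>: "\<pi> \<in> young_overgroup V F" and F: "subgroup F (BijGroup V)" and a: "a \<in> V"
  obtains \<sigma> where "\<sigma> \<in> F" "\<sigma> a = \<pi> a"
proof -
  let ?Y = "orbit ((BijGroup V)\<lparr>carrier := F\<rparr>) id a"
  have Y: "?Y = {\<sigma> a | \<sigma>. \<sigma> \<in> F}" by (auto simp: orbit_def)
  have "(\<lambda>x\<in>V. x) \<in> F" using subgroup.one_closed[OF F] by (simp add: BijGroup_def)
  then have "(\<lambda>x\<in>V. x) a \<in> ?Y" unfolding Y by blast
  then have "a \<in> ?Y" using a by simp
  moreover have "?Y \<in> orbits ((BijGroup V)\<lparr>carrier := F\<rparr>) V id"
    using a by (auto simp: orbits_def)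
  then have "\<pi> ` ?Y = ?Y" using \<pi> by (simp add: young_overgroup_def)
  ultimately have "\<pi> a \<in> ?Y" by blast
  then show ?thesis using that unfolding Y by force
qed

lemma subgroup_BijGroup_subset: "subgroup F (BijGroup V) \<Longrightarrow> F \<subseteq> Bij V"
  using subgroup.subset by (fastforce simp: BijGroup_def)

context rab
begin

lemma panel_iff: "P \<in> panels \<Delta> i \<longleftrightarrow> (\<exists>x\<in>C. P = A i `` {x})"
  by (auto simp: panels_def quotient_def)

lemma coloring_bij_betw:
  assumes "coloring i V \<mu>" "i \<in> I" "x \<in> C"
  shows "bij_betw \<mu> (A i `` {x}) V"
  unfolding bij_betw_def
proof
  show "inj_on \<mu> (A i `` {x})"
    using coloring_inj[OF assms(1,2)] adj_sym adj_trans assms(2) by (intro inj_onI) blast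
  show "\<mu> ` (A i `` {x}) = V"
    using coloringD(1,3)[OF assms(1)] adj_chambers[OF assms(2)] assms(3) by blast
qed

lemma legal_coloringD:
  assumes "legal_coloring \<Delta> \<Omega> lam" "i \<in> I"
  shows "coloring i (\<Omega> i) (lam i)"
  unfolding coloring_def
proof (intro conjI ballI impI)
  show "lam i x \<in> \<Omega> i" if "x \<in> C" for x
    using assms that by (auto simp: legal_coloring_def)
next
  fix j p assume j: "j \<in> I" "j \<noteq> i" "p \<in> A j"
  obtain x y where p: "p = (x, y)" by fastforce
  have x: "x \<in> C" using adj_chambers j p by blast
  then have "A j `` {x} \<in> panels \<Delta> j" using panel_iff by blast
  then have "lam i constant_on A j `` {x}" using assms j by (simp add: legal_coloring_def)
  moreover have "x \<in> A j `` {x}" "y \<in> A j `` {x}" using adj_refl j p x by auto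
  ultimately show "case p of (x, y) \<Rightarrow> lam i x = lam i y"
    unfolding constant_on_def p by auto
next
  fix x a assume x: "x \<in> C" and a: "a \<in> \<Omega> i"
  have "A i `` {x} \<in> panels \<Delta> i" using panel_iff x by blast
  then have "bij_betw (lam i) (A i `` {x}) (\<Omega> i)" using assms by (simp add: legal_coloring_def)
  then have inj: "inj_on (lam i) (A i `` {x})" and "a \<in> lam i ` A i `` {x}"
    using a by (simp_all add: bij_betw_def)
  then obtain y where y: "(x, y) \<in> A i" "lam i y = a" by blast
  show "\<exists>!y. (x, y) \<in> A i \<and> lam i y = a"
  proof (rule ex1I[of _ y])
    show "y' = y" if "(x, y') \<in> A i \<and> lam i y' = a" for y'
      using inj_onD[OF inj, of y' y] that y by simp
  qed (use y in simp)
qed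

lemma AutD:
  assumes "g \<in> Aut \<Delta>"
  shows "bij_betw g C C" "g \<in> extensional C" "x \<in> C \<Longrightarrow> g x \<in> C"
    and "i \<in> I \<Longrightarrow> x \<in> C \<Longrightarrow> y \<in> C \<Longrightarrow> (g x, g y) \<in> A i \<longleftrightarrow> (x, y) \<in> A i"
  using assms by (auto simp: Aut_def Bij_def dest: bij_betwE)

lemma Aut_adj: "g \<in> Aut \<Delta> \<Longrightarrow> i \<in> I \<Longrightarrow> (x, y) \<in> A i \<Longrightarrow> (g x, g y) \<in> A i"
  using AutD(4) adj_chambers by blast

lemma coloring_Aut:
  assumes g: "g \<in> Aut \<Delta>" and \<mu>: "coloring i V \<mu>" and i: "i \<in> I"
  shows "coloring i V (\<lambda>x. \<mu> (g x))"
  unfolding coloring_def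
proof (intro conjI ballI impI)
  show "\<mu> (g x) \<in> V" if "x \<in> C" for x
    using that coloringD(1)[OF \<mu>] AutD(3)[OF g] by blast
next
  fix j p assume "j \<in> I" "j \<noteq> i" "p \<in> A j"
  then show "case p of (x, y) \<Rightarrow> \<mu> (g x) = \<mu> (g y)"
    using coloringD(2)[OF \<mu>] Aut_adj[OF g] by (cases p) blast
next
  fix x a assume x: "x \<in> C" and a: "a \<in> V"
  obtain z where z: "(g x, z) \<in> A i" "\<mu> z = a"
    using coloringD(3)[OF \<mu> _ a] AutD(3)[OF g x] by blast
  then have "z \<in> g ` C" using AutD(1)[OF g] adj_chambers i by (auto simp: bij_betw_def)
  then obtain y where y: "y \<in> C" "z = g y" by blast
  show "\<exists>!y. (x, y) \<in> A i \<and> \<mu> (g y) = a"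
  proof (rule ex1I[of _ y])
    show "(x, y) \<in> A i \<and> \<mu> (g y) = a" using z y x i AutD(4)[OF g] by auto
    fix y' assume y': "(x, y') \<in> A i \<and> \<mu> (g y') = a"
    then have "(g x, g y') \<in> A i" using Aut_adj[OF g i] by blast
    then have "(g y', g y) \<in> A i" using z y i adj_sym adj_trans by blast
    then have "g y' = g y" using coloring_inj[OF \<mu> i] y' z y by simp
    moreover have "y' \<in> C" using y' adj_chambers i by blast
    ultimately show "y' = y" using AutD(1)[OF g] y by (meson bij_betw_imp_inj_on inj_onD)
  qed
qed

lemma local_action_apply:
  assumes "coloring i (\<Omega> i) (lam i)" "i \<in> I" "(x, y) \<in> A i"
  shows "local_action \<Omega> lam g i (A i `` {x}) (lam i y) = lam i (g y)"
proof -
  have x: "x \<in> C" "y \<in> C" using assms adj_chambers by auto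
  have "inv_into (A i `` {x}) (lam i) (lam i y) = y"
    using coloring_bij_betw[OF assms(1,2) x(1)] assms(3) by (simp add: bij_betw_def)
  then show ?thesis using coloringD(1)[OF assms(1) x(2)] by (simp add: local_action_def)
qed

lemma local_action_eqI:
  assumes "coloring i (\<Omega> i) (lam i)" "i \<in> I" "x \<in> C" "\<sigma> \<in> extensional (\<Omega> i)"
    and "\<And>y. (x, y) \<in> A i \<Longrightarrow> lam i (g y) = \<sigma> (lam i y)"
  shows "local_action \<Omega> lam g i (A i `` {x}) = \<sigma>"
proof
  fix \<omega>
  show "local_action \<Omega> lam g i (A i `` {x}) \<omega> = \<sigma> \<omega>"
  proof (cases "\<omega> \<in> \<Omega> i")
    case True
    then obtain y where y: "(x, y) \<in> A i" "lam i y = \<omega>"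
      using coloringD(3)[OF assms(1,3)] by blast
    show ?thesis
      using local_action_apply[where \<Omega>=\<Omega> and lam=lam, OF assms(1,2) y(1), of g] assms(5)[OF y(1)] y(2)
      by simp
  next
    case False
    then show ?thesis using extensional_arb[OF assms(4) False] by (simp add: local_action_def)
  qed
qed

lemma local_action_cong:
  assumes "coloring i (\<Omega> i) (lam i)" "i \<in> I" "x \<in> C"
    and "\<And>y. (x, y) \<in> A i \<Longrightarrow> lam i (g y) = lam i (h y)"
  shows "local_action \<Omega> lam g i (A i `` {x}) = local_action \<Omega> lam h i (A i `` {x})"
  using local_action_apply[where \<Omega>=\<Omega> and lam=lam and i=i, OF assms(1,2)] assms
  by (intro local_action_eqI) (auto simp: local_action_def)

text \<open>The witness is the inverse of \<open>g\<close> composed with \<open>h\<close>,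
  restricted to \<open>C\<close> so that it is extensional; it fixes \<open>S\<close> because
  \<open>h\<close> and \<open>g\<close> agree there.\<close>

lemma Aut_coset_memI:
  assumes g: "g \<in> Aut \<Delta>" and h: "h \<in> Aut \<Delta>" and "S \<subseteq> C" and eq: "\<And>x. x \<in> S \<Longrightarrow> h x = g x"
  shows "h \<in> g <#\<^bsub>Aut_group \<Delta>\<^esub> pointwise_stabilizer \<Delta> S"
proof -
  let ?k = "restrict (\<lambda>x. inv_into C g (h x)) C"
  note bg = AutD(1)[OF g] and bh = AutD(1)[OF h]
  have gk: "g (?k x) = h x" "?k x \<in> C" if "x \<in> C" for x
  proof -
    have "h x \<in> g ` C" using bg AutD(3)[OF h that] by (simp add: bij_betw_def)
    then show "g (?k x) = h x" "?k x \<in> C" using that by (auto simp: f_inv_into_f inv_into_into)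
  qed
  have "bij_betw (\<lambda>x. inv_into C g (h x)) C C"
    using bij_betw_trans[OF bh bij_betw_inv_into[OF bg]] by (simp add: o_def)
  then have "?k \<in> Bij C" by (auto simp: Bij_def cong: bij_betw_cong)
  moreover have "(x, y) \<in> A i \<longleftrightarrow> (?k x, ?k y) \<in> A i" if "i \<in> I" "x \<in> C" "y \<in> C" for i x y
    using AutD(4)[OF g that(1), of "?k x" "?k y"] AutD(4)[OF h that] gk that by metis
  ultimately have k: "?k \<in> Aut \<Delta>" unfolding Aut_def by blast
  have "?k x = x" if "x \<in> S" for x
    using that assms(3) eq bg by (auto simp: bij_betw_def inv_into_f_f subset_iff)
  then have "?k \<in> pointwise_stabilizer \<Delta> S" using k by (simp add: pointwise_stabilizer_def)
  moreover have "h = g \<otimes>\<^bsub>Aut_group \<Delta>\<^esub> ?k"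
  proof -
    have "?k \<in> Bij C" "g \<in> Bij C" using k g by (simp_all add: Aut_def)
    then have "g \<otimes>\<^bsub>Aut_group \<Delta>\<^esub> ?k = compose C g ?k"
      by (simp add: Aut_group_def BijGroup_def)
    also have "\<dots> = h"
    proof (rule extensionalityI[OF _ AutD(2)[OF h]])
      fix x assume "x \<in> C"
      then show "compose C g ?k x = h x" using gk[of x] by (simp add: compose_eq)
    qed simp
    finally show ?thesis by simp
  qed
  ultimately show ?thesis unfolding l_coset_def by blast
qed

text \<open>With each \<open>h\<close> the set contains the left coset of \<open>h\<close> by the
  pointwise stabilizer of \<open>P\<close>.\<close>

lemma openin_agreement_set:
  assumes "finite P" "P \<subseteq> C"
  shows "openin (permutation_topology \<Delta>) {h \<in> Aut \<Delta>. \<forall>x\<in>P. h x = g x}"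
  unfolding openin_permutation_topology perm_open_def
proof (intro conjI ballI exI)
  fix h assume h: "h \<in> {h \<in> Aut \<Delta>. \<forall>x\<in>P. h x = g x}"
  show "h <#\<^bsub>Aut_group \<Delta>\<^esub> pointwise_stabilizer \<Delta> P \<subseteq> {h \<in> Aut \<Delta>. \<forall>x\<in>P. h x = g x}"
  proof
    fix y assume "y \<in> h <#\<^bsub>Aut_group \<Delta>\<^esub> pointwise_stabilizer \<Delta> P"
    then obtain k where k: "k \<in> Aut \<Delta>" "\<And>x. x \<in> P \<Longrightarrow> k x = x" "y = h \<otimes>\<^bsub>Aut_group \<Delta>\<^esub> k"
      by (auto simp: l_coset_def pointwise_stabilizer_def)
    have "k \<in> Bij C" "h \<in> Bij C" using k h by (simp_all add: Aut_def)
    then have "y = compose C h k" using k by (simp add: Aut_group_def BijGroup_def)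
    then have "y x = g x" if "x \<in> P" for x
      using that k h assms(2) by (auto simp: compose_def)
    then show "y \<in> {h \<in> Aut \<Delta>. \<forall>x\<in>P. h x = g x}" using Aut_compose[OF _ k(1), of h] h k by blast
  qed
qed (use assms in auto)

end

section \<open>Density: approximation on balls\<close>

context pointed_rab
begin

lemma restricted_universal_group_dense:
  fixes \<Omega> :: "'i \<Rightarrow> 'c set"
  assumes fin: "\<And>j x. j \<in> I \<Longrightarrow> x \<in> C \<Longrightarrow> finite (A j `` {x})" "finite I"
    and lam: "\<And>i. i \<in> I \<Longrightarrow> coloring i (\<Omega> i) (lam i)"
    and F: "\<And>i. i \<in> I \<Longrightarrow> subgroup (F i) (BijGroup (\<Omega> i))"
    and FF': "\<And>i. i \<in> I \<Longrightarrow> F i \<subseteq> F' i \<and> F' i \<subseteq> young_overgroup (\<Omega> i) (F i)"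
    and rung: "\<And>i. i \<in> I \<Longrightarrow> rung_type I M i \<Longrightarrow> F i = F' i"
    and g: "g \<in> universal_group \<Delta> \<Omega> lam F'"
  obtains h where "h \<in> restricted_universal_group \<Delta> \<Omega> lam F F'"
    "\<And>x. x \<in> C \<Longrightarrow> len x \<le> n \<Longrightarrow> h x = g x"
proof -
  have gA: "g \<in> Aut \<Delta>" using g by (simp add: universal_group_def)
  have la: "local_action \<Omega> lam g i (A i `` {x}) \<in> F' i" if "i \<in> I" "x \<in> C" for i x
  proof -
    have "A i `` {x} \<in> panels \<Delta> i" using that panel_iff by blast
    then show ?thesis using g that by (simp add: universal_group_def)
  qed
  \<comment> \<open>The requirements on a new component \<open>f\<close>: away from the finite set
    \<open>N\<close> it differs from \<open>lam i\<close> on each \<open>i\<close>-panel by an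
    element of \<open>F i\<close>, and on the panels of \<open>N\<close> it equals the old
    component.\<close>
  define good where "good = (\<lambda>i f N. coloring i (\<Omega> i) f \<and>
      (\<forall>x\<in>C. len x \<le> n \<longrightarrow> f x = lam i (g x)) \<and> finite N \<and>
      (\<forall>x\<in>N. \<forall>y. (x, y) \<in> A i \<longrightarrow> f y = lam i (g y)) \<and>
      (\<forall>x\<in>C - N. \<exists>\<sigma>\<in>F i. \<forall>y. (x, y) \<in> A i \<longrightarrow> f y = \<sigma> (lam i y)))"
  have "\<exists>f N. good i f N" if i: "i \<in> I" for i
  proof (cases "rung_type I M i")
    case True
    \<comment> \<open>For the type of a rung, \<open>F i = F' i\<close> already contains all local
      actions of \<open>g\<close>, so the component is kept with empty exceptional set.\<close>
    have "\<exists>\<sigma>\<in>F i. \<forall>y. (x, y) \<in> A i \<longrightarrow> lam i (g y) = \<sigma> (lam i y)" if "x \<in> C" for x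
      using local_action_apply[where \<Omega>=\<Omega> and lam=lam and i=i, OF lam[OF i] i, symmetric] la[OF i that] rung[OF i True] by metis
    then show ?thesis
      using coloring_Aut[OF gA lam[OF i] i]
      by (intro exI[of _ "\<lambda>x. lam i (g x)"] exI[of _ "{}"]) (auto simp: good_def)
  next
    case False
    \<comment> \<open>Two types commuting with \<open>i\<close> but not with each other would make
      \<open>i\<close> the type of a rung.\<close>
    have comm: "M j k = 2" if "j \<in> I" "k \<in> I" "M i j = 2" "M i k = 2" "j \<noteq> k" for j k
    proof -
      have "rung_type I M i" if "M j k = \<infinity>"
        unfolding rung_type_def
        by (intro conjI i bexI[of _ j] bexI[of _ k]) (fact that \<open>j \<in> I\<close> \<open>k \<in> I\<close> \<open>M i j = 2\<close> \<open>M i k = 2\<close>)+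
      then have "M j k \<noteq> \<infinity>" using False by blast
      then show ?thesis
        using M_cases[OF \<open>j \<in> I\<close> \<open>k \<in> I\<close> \<open>j \<noteq> k\<close>] by (elim disjE) simp_all
    qed
    have bij: "bij_betw \<sigma> (\<Omega> i) (\<Omega> i)" if "\<sigma> \<in> F i" for \<sigma>
      using subgroup_BijGroup_subset[OF F[OF i]] that by (auto simp: Bij_def)
    have orb: "\<exists>\<sigma>\<in>F i. \<sigma> (lam i x) = lam i (g x)" if x: "x \<in> C" for x
    proof -
      let ?\<pi> = "local_action \<Omega> lam g i (A i `` {x})"
      have "?\<pi> \<in> young_overgroup (\<Omega> i) (F i)" using la FF' i x by blast
      then obtain \<sigma> where "\<sigma> \<in> F i" "\<sigma> (lam i x) = ?\<pi> (lam i x)"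
        using young_overgroup_orbit F[OF i] coloringD(1)[OF lam[OF i] x] by metis
      then show ?thesis
        using local_action_apply[where \<Omega>=\<Omega> and lam=lam and i=i, OF lam[OF i] i adj_refl[OF i x]] by metis
    qed
    obtain f N where "coloring i (\<Omega> i) f" "\<And>x. x \<in> C \<Longrightarrow> len x \<le> n \<Longrightarrow> f x = lam i (g x)"
      "finite N" "\<And>x y. x \<in> N \<Longrightarrow> (x, y) \<in> A i \<Longrightarrow> f y = lam i (g y)"
      "\<And>x. x \<in> C - N \<Longrightarrow> \<exists>\<sigma>\<in>F i. \<forall>y. (x, y) \<in> A i \<longrightarrow> f y = \<sigma> (lam i y)"
      using recoloring_exists[OF i lam[OF i] coloring_Aut[OF gA lam[OF i] i] fin comm bij orb]
      by blast
    then have "good i f N" unfolding good_def by blast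
    then show ?thesis by blast
  qed
  then obtain f N where fN: "\<And>i. i \<in> I \<Longrightarrow> good i (f i) (N i)" by metis
  have f: "i \<in> I \<Longrightarrow> coloring i (\<Omega> i) (f i)"
    "i \<in> I \<Longrightarrow> x \<in> C \<Longrightarrow> len x \<le> n \<Longrightarrow> f i x = lam i (g x)"
    "i \<in> I \<Longrightarrow> finite (N i)"
    "i \<in> I \<Longrightarrow> x \<in> N i \<Longrightarrow> (x, y) \<in> A i \<Longrightarrow> f i y = lam i (g y)"
    "i \<in> I \<Longrightarrow> x \<in> C - N i \<Longrightarrow> \<exists>\<sigma>\<in>F i. \<forall>y. (x, y) \<in> A i \<longrightarrow> f i y = \<sigma> (lam i y)"
    for i x y
    using fN[of i] unfolding good_def by blast+
  \<comment> \<open>The colors prescribed at \<open>c\<close> are those of \<open>g c\<close>, since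
    \<open>c\<close> has length 0 and lies in every ball.\<close>
  obtain h where h: "h \<in> Aut \<Delta>" "h c = g c"
    "\<And>x i. x \<in> C \<Longrightarrow> i \<in> I \<Longrightarrow> lam i (h x) = f i x"
    using automorphism_exists[of c "g c" \<Omega> f lam] base AutD(3)[OF gA base] f(1) lam f(2) len_base
    by (metis le0)
  have hy: "lam i (h y) = f i y" if "i \<in> I" "(x, y) \<in> A i" for i x y
    using h(3) that adj_chambers by blast
  have outside: "local_action \<Omega> lam h i (A i `` {x}) \<in> F i" if ix: "i \<in> I" "x \<in> C - N i" for i x
  proof -
    obtain \<sigma> where \<sigma>: "\<sigma> \<in> F i" "\<And>y. (x, y) \<in> A i \<Longrightarrow> f i y = \<sigma> (lam i y)"
      using f(5)[OF ix] by blast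
    have "\<sigma> \<in> extensional (\<Omega> i)"
      using subgroup_BijGroup_subset[OF F[OF that(1)]] \<sigma>(1) by (auto simp: Bij_def)
    then have "local_action \<Omega> lam h i (A i `` {x}) = \<sigma>"
      using \<sigma> hy that lam by (intro local_action_eqI) auto
    then show ?thesis using \<sigma> by simp
  qed
  have inside: "local_action \<Omega> lam h i (A i `` {x}) \<in> F' i" if "i \<in> I" "x \<in> C" "x \<in> N i" for i x
  proof -
    have "local_action \<Omega> lam h i (A i `` {x}) = local_action \<Omega> lam g i (A i `` {x})"
      using hy f(4) that lam by (intro local_action_cong) auto
    then show ?thesis using la that by simp
  qed
  \<comment> \<open>By \<open>outside\<close>, an exceptional \<open>i\<close>-panel is the panel of
    some chamber of the finite set \<open>N i\<close>.\<close>
  have "finite {P \<in> panels \<Delta> i. local_action \<Omega> lam h i P \<notin> F i}" if i: "i \<in> I" for i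
  proof (rule finite_subset)
    show "{P \<in> panels \<Delta> i. local_action \<Omega> lam h i P \<notin> F i} \<subseteq> (\<lambda>x. A i `` {x}) ` N i"
      using outside[OF i] by (auto simp: panel_iff)
  qed (use f(3) i in simp)
  moreover have "local_action \<Omega> lam h i P \<in> F' i" if "i \<in> I" "P \<in> panels \<Delta> i" for i P
    using that outside inside FF' unfolding panel_iff by blast
  ultimately have "h \<in> restricted_universal_group \<Delta> \<Omega> lam F F'"
    using h(1) by (simp add: restricted_universal_group_def G_group_def universal_group_def)
  moreover have "h x = g x" if x: "x \<in> C" "len x \<le> n" for x
  proof (rule chamber_maps_agree[where \<nu>=lam and V=\<Omega> and f=h and g=g and n=n, OF lam _ _ h(2) _ x])
    show "lam i (h y) = lam i (g y)" if "y \<in> C" "i \<in> I" "len y \<le> n" for y i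
      using h(3)[OF that(1,2)] f(2)[OF that(2,1,3)] by simp
  qed (use Aut_adj h(1) gA in blast)+
  ultimately show ?thesis using that by blast
qed

end

section \<open>The closure in the permutation topology\<close>

theorem proposition6p6:
  fixes \<Delta> :: "('i, 'a) chamber_system"
    and M :: "'i \<Rightarrow> 'i \<Rightarrow> enat"
    and q :: "'i \<Rightarrow> nat"
    and \<Omega> :: "'i \<Rightarrow> 'c set"
    and lam :: "'i \<Rightarrow> 'a \<Rightarrow> 'c"
    and F F' :: "'i \<Rightarrow> ('c \<Rightarrow> 'c) set"
  assumes "finite (types \<Delta>)"
    and "right_angled_building M \<Delta>"
    and "locally_finite_semiregular \<Delta> q"
    and "\<forall>i\<in>types \<Delta>. finite (\<Omega> i) \<and> card (\<Omega> i) = q i"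
    and "legal_coloring \<Delta> \<Omega> lam"
    and "local_data (types \<Delta>) \<Omega> F"
    and "local_data (types \<Delta>) \<Omega> F'"
    and "\<forall>i\<in>types \<Delta>. F i \<subseteq> F' i \<and> F' i \<subseteq> young_overgroup (\<Omega> i) (F i)"
    and "\<forall>i\<in>types \<Delta>. rung_type (types \<Delta>) M i \<longrightarrow> F i = F' i"
  shows "permutation_topology \<Delta> closure_of restricted_universal_group \<Delta> \<Omega> lam F F'
           = universal_group \<Delta> \<Omega> lam F'"
proof -
  obtain \<delta> where "weyl_distance M \<Delta> \<delta>"
    using assms(2) by (auto simp: right_angled_building_def building_def)
  then interpret rab \<Delta> M \<delta>
    using assms(2) by unfold_locales (auto simp: right_angled_building_def building_def)
  obtain c where c: "c \<in> C"
    using assms(2) by (auto simp: right_angled_building_def building_def)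
  interpret pointed_rab \<Delta> M \<delta> c by unfold_locales (rule c)
  have fin: "finite (A j `` {x})" if "j \<in> I" "x \<in> C" for j x
    using assms(3) that panel_iff by (force simp: locally_finite_semiregular_def)
  have lam: "coloring i (\<Omega> i) (lam i)" if "i \<in> I" for i
    using legal_coloringD assms(5) that .
  let ?G = "restricted_universal_group \<Delta> \<Omega> lam F F'" and ?U = "universal_group \<Delta> \<Omega> lam F'"
  show ?thesis
  proof (intro subset_antisym subsetI)
    fix g assume g: "g \<in> permutation_topology \<Delta> closure_of ?G"
    then have gA: "g \<in> Aut \<Delta>" by (simp add: in_closure_of topspace_permutation_topology)
    have "local_action \<Omega> lam g i P \<in> F' i" if i: "i \<in> I" and P: "P \<in> panels \<Delta> i" for i P
    proof -
      obtain x where x: "x \<in> C" "P = A i `` {x}" using P panel_iff by blast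
      \<comment> \<open>By local finiteness, agreement with \<open>g\<close> on the whole panel is
        an open condition, so some \<open>h\<close> in \<open>?G\<close> satisfies it and has the
        same local action there.\<close>
      have "finite P" "P \<subseteq> C" using fin i x adj_chambers by auto
      then have "openin (permutation_topology \<Delta>) {h \<in> Aut \<Delta>. \<forall>x\<in>P. h x = g x}"
        by (rule openin_agreement_set)
      then have "\<exists>h. h \<in> ?G \<and> h \<in> {h \<in> Aut \<Delta>. \<forall>x\<in>P. h x = g x}"
        using g gA unfolding in_closure_of mem_Collect_eq
        by (elim conjE allE[where x="{h \<in> Aut \<Delta>. \<forall>x\<in>P. h x = g x}"]) simp
      then obtain h where h: "h \<in> ?G" "\<forall>x\<in>P. h x = g x" by blast
      have "local_action \<Omega> lam g i P = local_action \<Omega> lam h i P"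
        unfolding x(2) using h(2) x lam i by (intro local_action_cong) auto
      then show ?thesis
        using h(1) i P by (simp add: restricted_universal_group_def universal_group_def)
    qed
    then show "g \<in> ?U" using gA by (simp add: universal_group_def)
  next
    fix g assume g: "g \<in> ?U"
    then have gA: "g \<in> Aut \<Delta>" by (simp add: universal_group_def)
    have "\<exists>h\<in>?G. h \<in> T" if T: "g \<in> T" "openin (permutation_topology \<Delta>) T" for T
    proof -
      obtain S where S: "finite S" "S \<subseteq> C"
        "g <#\<^bsub>Aut_group \<Delta>\<^esub> pointwise_stabilizer \<Delta> S \<subseteq> T"
        using T unfolding openin_permutation_topology perm_open_def by blast
      \<comment> \<open>The radius is the largest length occurring in \<open>S\<close>, so the ball
        contains \<open>S\<close>; for empty \<open>S\<close> the radius is unspecified, but then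
        agreement on \<open>S\<close> is vacuous.\<close>
      obtain h where h: "h \<in> ?G" "\<And>x. x \<in> C \<Longrightarrow> len x \<le> Max (len ` S) \<Longrightarrow> h x = g x"
      proof (rule restricted_universal_group_dense[OF fin assms(1) lam _ _ _ g, of F])
        show "subgroup (F i) (BijGroup (\<Omega> i))" if "i \<in> I" for i
          using assms(6) that by (simp add: local_data_def)
      qed (use assms(8,9) in blast)+
      have "h \<in> Aut \<Delta>" using h(1) by (simp add: restricted_universal_group_def universal_group_def)
      moreover have "h x = g x" if "x \<in> S" for x using that S h(2) by auto
      ultimately show ?thesis using Aut_coset_memI[OF gA] S h(1) by blast
    qed
    then show "g \<in> permutation_topology \<Delta> closure_of ?G"
      using gA unfolding in_closure_of topspace_permutation_topology by blast
  qed
qed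

end
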